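(* Let $p$ be a prime, and let $s(n)_{n\geq 0}$ be a sequence of $p$-adic integers satisfying a linear recurrence $s(n+\ell)+a_{\ell-1}s(n+\ell-1)+\cdots+a_1 s(n+1)+a_0 s(n)=0$ for all $n\ge 0$, with constant coefficients $a_i\in\mathbb{Z}_p$ (so its characteristic polynomial $g(x)=x^\ell+a_{\ell-1}x^{\ell-1}+\cdots+a_0\in\mathbb{Z}_p[x]$ is monic). Then there exists an analytic approximate twisted interpolation of $s(n)_{n\geq 0}$ to $\mathbb{Z}_p$.
   Context: $\mathbb N=\{0,1,2,\dots\}$. Let $p$ be a prime, $q\ge1$ a power of $p$, and $s(n)_{n\ge0}$ a sequence of $p$-adic integers. Suppose $\mathbb N=\bigcup_{j\in J}A_j$ is a finite partition of $\mathbb N$ such that each $A_j$ is dense in $r_j+q\mathbb{Z}_p$ for some $0\le r_j\le q-1$; let $K$ be a finite extension of $\mathbb{Q}_p$ with its unique absolute value $|\cdot|_p$ extending that of $\mathbb{Q}_p$, and for each $j$ let $s_j:\mathbb{Z}_p\to K$ be continuous. The family $\{(s_j,A_j):j\in J\}$ is an approximate twisted interpolation of $s(n)_{n\ge 0}$ to $\mathbb{Z}_p$ if there are constants $C\ge 0$ and $0\le D<1$ with $|s(n)-s_j(n)|_p\le CD^n$ for all $n\in A_j$ and all $j\in J$. It is analytic if for each $j$ the function $x\mapsto s_j(qx+r_j)$, $x\in\mathbb{Z}_p$, is given by a power series in $x$ with coefficients in $K$ converging on all of $\mathbb{Z}_p$. *)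

theory Defs
  imports "HOL-Analysis.Analysis" "HOL-Computational_Algebra.Computational_Algebra"
begin

text \<open>Ambient model.  All p-adic objects live inside a field type 'k carrying a
  function v :: 'k => real, which is a non-archimedean absolute value restricting to the
  p-adic absolute value on the integers, such that Cauchy sequences of rationals converge
  (so the closure of the rationals is a copy of Q_p), and 'k is algebraically closed
  (so every finite extension of Q_p embeds into 'k, e.g. 'k = algebraic closure of Q_p
  or C_p).  Q_p and Z_p are the closures of the rationals / integers in 'k.\<close>

definition vlim :: "('k::field_char_0 \<Rightarrow> real) \<Rightarrow> (nat \<Rightarrow> 'k) \<Rightarrow> 'k \<Rightarrow> bool" where
  "vlim v f L \<longleftrightarrow> ((\<lambda>n. v (f n - L)) \<longlonglongrightarrow> 0)"

definition nonarch_abs :: "('k::field_char_0 \<Rightarrow> real) \<Rightarrow> bool" where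
  "nonarch_abs v \<longleftrightarrow> (\<forall>x. v x \<ge> 0) \<and> (\<forall>x. v x = 0 \<longleftrightarrow> x = 0)
     \<and> (\<forall>x y. v (x * y) = v x * v y) \<and> (\<forall>x y. v (x + y) \<le> max (v x) (v y))"

definition padic_ambient :: "nat \<Rightarrow> ('k::field_char_0 \<Rightarrow> real) \<Rightarrow> bool" where
  "padic_ambient p v \<longleftrightarrow> nonarch_abs v
     \<and> (\<forall>n::int. n \<noteq> 0 \<longrightarrow> v (of_int n) = inverse (real p) ^ multiplicity (int p) n)
     \<and> (\<forall>f::nat \<Rightarrow> 'k. (\<forall>n. f n \<in> range of_rat)
           \<and> (\<forall>e>0. \<exists>N. \<forall>m\<ge>N. \<forall>n\<ge>N. v (f m - f n) < e) \<longrightarrow> (\<exists>L. vlim v f L))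
     \<and> (\<forall>g::'k poly. degree g > 0 \<longrightarrow> (\<exists>x. poly g x = 0))"

definition Zp :: "('k::field_char_0 \<Rightarrow> real) \<Rightarrow> 'k set" where
  "Zp v = {x. \<exists>a::nat \<Rightarrow> int. vlim v (\<lambda>n. of_int (a n)) x}"

definition Qp :: "('k::field_char_0 \<Rightarrow> real) \<Rightarrow> 'k set" where
  "Qp v = {x. \<exists>a::nat \<Rightarrow> rat. vlim v (\<lambda>n. of_rat (a n)) x}"

definition subfield_of :: "'k::field set \<Rightarrow> bool" where
  "subfield_of K \<longleftrightarrow> 0 \<in> K \<and> 1 \<in> K \<and> (\<forall>x\<in>K. \<forall>y\<in>K. x + y \<in> K \<and> x * y \<in> K)
     \<and> (\<forall>x\<in>K. - x \<in> K \<and> inverse x \<in> K)"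

definition finite_ext_Qp :: "('k::field_char_0 \<Rightarrow> real) \<Rightarrow> 'k set \<Rightarrow> bool" where
  "finite_ext_Qp v K \<longleftrightarrow> subfield_of K \<and> Qp v \<subseteq> K
     \<and> (\<exists>(d::nat) (b::nat \<Rightarrow> 'k). (\<forall>i<d. b i \<in> K)
          \<and> K \<subseteq> {\<Sum>i<d. c i * b i | c. \<forall>i<d. c i \<in> Qp v})"

definition coset_Zp :: "('k::field_char_0 \<Rightarrow> real) \<Rightarrow> nat \<Rightarrow> nat \<Rightarrow> 'k set" where
  "coset_Zp v r q = {of_nat r + of_nat q * y | y. y \<in> Zp v}"

definition dense_in_Zp :: "('k::field_char_0 \<Rightarrow> real) \<Rightarrow> nat set \<Rightarrow> 'k set \<Rightarrow> bool" where
  "dense_in_Zp v A S \<longleftrightarrow> of_nat ` A \<subseteq> S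
     \<and> (\<forall>x\<in>S. \<forall>e>0. \<exists>n\<in>A. v (of_nat n - x) < e)"

definition continuous_on_Zp :: "('k::field_char_0 \<Rightarrow> real) \<Rightarrow> ('k \<Rightarrow> 'k) \<Rightarrow> bool" where
  "continuous_on_Zp v f \<longleftrightarrow> (\<forall>x\<in>Zp v. \<forall>e>0. \<exists>d>0. \<forall>y\<in>Zp v. v (y - x) < d \<longrightarrow> v (f y - f x) < e)"

definition approx_twisted_interp ::
  "nat \<Rightarrow> ('k::field_char_0 \<Rightarrow> real) \<Rightarrow> (nat \<Rightarrow> 'k) \<Rightarrow> nat \<Rightarrow> 'j set \<Rightarrow> ('j \<Rightarrow> nat set)
     \<Rightarrow> ('j \<Rightarrow> nat) \<Rightarrow> 'k set \<Rightarrow> ('j \<Rightarrow> 'k \<Rightarrow> 'k) \<Rightarrow> bool" where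
  "approx_twisted_interp p v s q J A r K sj \<longleftrightarrow>
     q \<ge> 1 \<and> (\<exists>e. q = p ^ e)
     \<and> finite J \<and> (\<Union>j\<in>J. A j) = UNIV
     \<and> (\<forall>i\<in>J. \<forall>j\<in>J. i \<noteq> j \<longrightarrow> A i \<inter> A j = {})
     \<and> (\<forall>j\<in>J. r j \<le> q - 1 \<and> dense_in_Zp v (A j) (coset_Zp v (r j) q))
     \<and> finite_ext_Qp v K
     \<and> (\<forall>j\<in>J. sj j ` Zp v \<subseteq> K \<and> continuous_on_Zp v (sj j))
     \<and> (\<exists>C D. C \<ge> 0 \<and> 0 \<le> D \<and> D < 1 \<and>
          (\<forall>j\<in>J. \<forall>n\<in>A j. v (s n - sj j (of_nat n)) \<le> C * D ^ n))"

definition analytic_interp ::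
  "('k::field_char_0 \<Rightarrow> real) \<Rightarrow> nat \<Rightarrow> 'j set \<Rightarrow> ('j \<Rightarrow> nat) \<Rightarrow> 'k set \<Rightarrow> ('j \<Rightarrow> 'k \<Rightarrow> 'k) \<Rightarrow> bool" where
  "analytic_interp v q J r K sj \<longleftrightarrow>
     (\<forall>j\<in>J. \<exists>c::nat \<Rightarrow> 'k. (\<forall>k. c k \<in> K) \<and>
        (\<forall>x\<in>Zp v. vlim v (\<lambda>N. \<Sum>k<N. c k * x ^ k) (sj j (of_nat q * x + of_nat (r j)))))"

end

theory Submission
  imports Defs
begin

text \<open>
  No roots of the characteristic polynomial are needed, and the field \<open>K\<close> can be taken to be \<open>\<rat>\<^sub>p\<close>.
  Let \<open>M\<close> be the lattice of \<open>\<int>\<^sub>p\<close>-valued solutions of the recurrence. Since \<open>M/pM\<close> is finite, some power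
  \<open>P\<^sub>0\<close> of the shift satisfies \<open>P\<^sub>0\<^sup>2 \<equiv> P\<^sub>0\<close> modulo \<open>p\<close>, hence \<open>P = P\<^sub>0\<^sup>p\<close>, the shift by some \<open>T\<close>, satisfies
  \<open>P\<^sup>2 \<equiv> P\<close> modulo \<open>p\<^sup>2\<close>. The powers of \<open>P\<close> with exponent \<open>p\<^sup>h\<close> converge to an idempotent \<open>E\<close>. As
  \<open>P(P - 1)\<close> is divisible by \<open>p\<^sup>2\<close>, the operator \<open>P\<^sup>m(1 - E) = (P(1 - E))\<^sup>m\<close> is divisible by \<open>p\<^sup>2\<^sup>m\<close>, so
  replacing \<open>s\<close> by \<open>E s\<close> costs an exponentially small error, while \<open>(P - 1)\<^sup>k E\<close> is divisible by \<open>p\<^sup>2\<^sup>k\<close>.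
  So along a residue class modulo \<open>T\<close> the sequence \<open>E s\<close> has a Newton series whose \<open>k\<close>-th coefficient is
  divisible by \<open>p\<^sup>2\<^sup>k\<close>; as \<open>k!\<close> divides \<open>p\<^sup>k\<close> up to a \<open>p\<close>-adic unit, it can be rearranged into a power series.
  Finally, if \<open>q\<close> is the \<open>p\<close>-part of \<open>T\<close>, a residue class modulo \<open>T\<close> is dense in the corresponding coset
  of \<open>q\<int>\<^sub>p\<close>, because \<open>T/q\<close> is a unit of \<open>\<int>\<^sub>p\<close>.
\<close>

section \<open>Idempotents modulo a filtration\<close>

lemma power_diff_dvd: "(x::'a::comm_ring_1) - y dvd x ^ n - y ^ n"
  by (simp add: power_diff_sumr2)

text \<open>Abstract form of the ideals of operators divisible by \<open>p ^ k\<close>.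
  \<open>I_0\<close> and \<open>I_mult\<close> together make each \<open>I k\<close> absorb
  arbitrary factors.\<close>

locale filtration =
  fixes I :: "nat \<Rightarrow> 'a::comm_ring_1 set" and p :: nat
  assumes I_0: "I 0 = UNIV"
    and I_add: "x \<in> I k \<Longrightarrow> y \<in> I k \<Longrightarrow> x + y \<in> I k"
    and I_mult: "x \<in> I j \<Longrightarrow> y \<in> I k \<Longrightarrow> x * y \<in> I (j + k)"
    and I_Suc: "I (Suc k) \<subseteq> I k"
    and I_p: "of_nat p \<in> I 1"
begin

lemma I_antimono: "j \<le> k \<Longrightarrow> x \<in> I k \<Longrightarrow> x \<in> I j"
  using lift_Suc_antimono_le[of I j k] I_Suc by blast

lemma I_mult_left: "y \<in> I k \<Longrightarrow> x * y \<in> I k"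
  using I_mult[of x 0 y k] by (simp add: I_0)

lemma I_mult_right: "x \<in> I k \<Longrightarrow> x * y \<in> I k"
  using I_mult_left[of x k y] by (simp add: mult.commute)

lemma I_dvd: "x dvd y \<Longrightarrow> x \<in> I k \<Longrightarrow> y \<in> I k"
  by (auto simp: dvd_def I_mult_right)

lemma I_minus: "x \<in> I k \<Longrightarrow> - x \<in> I k"
  using I_mult_left[of x k "-1"] by simp

lemma I_diff: "x \<in> I k \<Longrightarrow> y \<in> I k \<Longrightarrow> x - y \<in> I k"
  using I_add[of x k "- y"] I_minus[of y k] by simp

lemma I_zero: "0 \<in> I k"
proof -
  have "0 \<in> I k" if "x \<in> I k" for x using I_mult_left[OF that, of 0] by simp
  \<comment> \<open>Nonemptiness of \<open>I k\<close> comes from multiplying by \<open>p\<close>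
    once per level.\<close>
  moreover have "\<exists>x. x \<in> I k"
  proof (induction k)
    case (Suc k)
    then show ?case using I_mult[OF _ I_p] by fastforce
  qed (simp add: I_0)
  ultimately show ?thesis by blast
qed

lemma I_sum: "(\<And>i. i \<in> A \<Longrightarrow> f i \<in> I k) \<Longrightarrow> sum f A \<in> I k"
  by (induction A rule: infinite_finite_induct) (auto simp: I_zero I_add)

lemma I_power: "x \<in> I k \<Longrightarrow> x ^ n \<in> I (k * n)"
proof (induction n)
  case (Suc n)
  then show ?case using I_mult[of x k "x ^ n" "k * n"] by simp
qed (simp add: I_0)

lemma I_diff_power: 
  assumes "x - y \<in> I k"
  shows "x ^ n - y ^ n \<in> I k"
  using I_dvd[OF power_diff_dvd assms] .

text \<open>The cofactor of \<open>x - y\<close> in \<open>x ^ p - y ^ p\<close> is congruent to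
  \<open>p * y ^ (p - 1)\<close> modulo \<open>I 1\<close>, hence lies in \<open>I 1\<close>: taking
  \<open>p\<close>-th powers gains one level.\<close>

lemma I_diff_power_p:
  assumes "x - y \<in> I (Suc k)"
  shows "x ^ p - y ^ p \<in> I (Suc (Suc k))"
proof -
  have xy: "x - y \<in> I 1" using I_antimono[OF _ assms, of 1] by simp
  have "(\<Sum>i<p. y ^ (p - Suc i) * (x ^ i - y ^ i)) \<in> I 1"
    by (intro I_sum I_mult_left I_diff_power xy)
  moreover have "(\<Sum>i<p. y ^ (p - Suc i) * y ^ i) = of_nat p * y ^ (p - 1)"
  proof -
    have "(\<Sum>i<p. y ^ (p - Suc i) * y ^ i) = (\<Sum>i<p. y ^ (p - 1))"
      by (intro sum.cong) (auto simp flip: power_add)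
    then show ?thesis by simp
  qed
  ultimately have "(\<Sum>i<p. y ^ (p - Suc i) * x ^ i) \<in> I 1"
    using I_add[of "\<Sum>i<p. y ^ (p - Suc i) * (x ^ i - y ^ i)" 1 "of_nat p * y ^ (p - 1)"]
      I_mult_right[OF I_p, of "y ^ (p - 1)"]
    by (simp only: right_diff_distrib sum_subtractf diff_add_cancel)
  then show ?thesis
    using I_mult[OF assms, of "\<Sum>i<p. y ^ (p - Suc i) * x ^ i" 1]
    by (simp only: power_diff_sumr2 add_Suc_right add_0_right One_nat_def)
qed

lemma I_idem_power:
  assumes "x ^ 2 - x \<in> I k" "n \<ge> 1"
  shows "x ^ n - x \<in> I k"
proof -
  have "x ^ Suc m - x \<in> I k" for m
  proof (induction m)
    case (Suc m)
    have "x ^ Suc (Suc m) - x = x * (x ^ Suc m - x) + (x ^ 2 - x)"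
      by (simp add: algebra_simps power2_eq_square)
    then show ?case using I_add[OF I_mult_left[OF Suc, of x] assms(1)] by (simp only:)
  qed (simp add: I_zero)
  then show ?thesis using assms(2) by (cases n) auto
qed

text \<open>Raising the congruence for \<open>h\<close> to the \<open>p\<close>-th power lifts
  idempotence by one level.\<close>

lemma I_idem_power_p_power:
  assumes "x ^ 2 - x \<in> I 1"
  shows "(x ^ p ^ h) ^ 2 - x ^ p ^ h \<in> I (Suc h)"
proof (induction h)
  case (Suc h)
  then show ?case using I_diff_power_p[of "(x ^ p ^ h) ^ 2" "x ^ p ^ h" h]
    by (simp add: ac_simps flip: power_mult)
qed (use assms in simp)

text \<open>An element idempotent modulo \<open>I 1\<close> agrees there with its
  \<open>p\<close>-th power, and every further \<open>p\<close>-th power gains one level. This makes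
  the approximate projections converge.\<close>

lemma I_p_power_Cauchy:
  assumes "x ^ 2 - x \<in> I 1" "p \<ge> 1"
  shows "x ^ p ^ Suc h - x ^ p ^ h \<in> I (Suc h)"
proof (induction h)
  case (Suc h)
  then show ?case using I_diff_power_p[of "x ^ p ^ Suc h" "x ^ p ^ h" h]
    by (simp add: ac_simps flip: power_mult)
qed (use I_idem_power assms in simp)

text \<open>As \<open>k \<le> n\<close>, each factor \<open>x - 1\<close> can be paired with a
  factor \<open>x\<close>, which gives \<open>(x ^ 2 - x) ^ k\<close>.\<close>

lemma I_diff_one_power:
  assumes "x ^ 2 - x \<in> I 2" "k \<le> n"
  shows "(x - 1) ^ k * x ^ n \<in> I (2 * k)"
proof -
  have "(x - 1) ^ k * x ^ n = (x ^ 2 - x) ^ k * x ^ (n - k)"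
  proof -
    have "x ^ 2 - x = (x - 1) * x" by (simp add: algebra_simps power2_eq_square)
    then have "(x ^ 2 - x) ^ k * x ^ (n - k) = (x - 1) ^ k * (x ^ k * x ^ (n - k))"
      by (simp add: power_mult_distrib mult.assoc)
    then show ?thesis using assms(2) by (simp flip: power_add)
  qed
  then show ?thesis using I_mult_right[OF I_power[OF assms(1), of k]] by simp
qed

text \<open>Because \<open>2 * m \<le> Suc h\<close>, the element \<open>d = 1 - x ^ p ^ h\<close>
  is idempotent modulo \<open>I (2 * m)\<close>. Hence \<open>x ^ m * d\<close> is congruent to
  \<open>(x * d) ^ m\<close>, and \<open>x * d\<close> is a multiple of \<open>x * (x - 1)\<close>,
  which lies in \<open>I 2\<close>.\<close>

lemma I_complement_power:
  assumes x: "x ^ 2 - x \<in> I 2" and h: "2 * m \<le> Suc h" and p: "p \<ge> 1"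
  shows "x ^ m * (x ^ p ^ h - 1) \<in> I (2 * m)"
\<comment> \<open>An idempotent need not be congruent to its zeroth power, so \<open>m = 0\<close>
  is treated apart; there \<open>I 0\<close> is the whole ring.\<close>
proof (cases "m = 0")
  case False
  define d where "d = 1 - x ^ p ^ h"
  have "d ^ 2 - d = (x ^ p ^ h) ^ 2 - x ^ p ^ h"
    by (simp add: d_def algebra_simps power2_eq_square)
  also have "\<dots> \<in> I (2 * m)"
    by (intro I_antimono[OF h I_idem_power_p_power] I_antimono[OF _ x, of 1]) simp
  finally have 1: "d ^ m - d \<in> I (2 * m)" by (rule I_idem_power) (use False in simp)
  have "x - 1 dvd x ^ p ^ h - 1" using power_diff_dvd[of x 1] by simp
  then have "x - 1 dvd - d" by (simp only: d_def minus_diff_eq)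
  then have "x * (x - 1) dvd x * d" by (intro mult_dvd_mono) auto
  moreover have "x * (x - 1) \<in> I 2" using x by (simp add: power2_eq_square right_diff_distrib)
  ultimately have "x * d \<in> I 2" by (rule I_dvd)
  then have "(x * d) ^ m \<in> I (2 * m)" by (rule I_power)
  moreover have "x ^ m * (x ^ p ^ h - 1) = x ^ m * (d ^ m - d) - (x * d) ^ m"
  proof -
    have "x ^ p ^ h - 1 = - d" by (simp add: d_def)
    then show ?thesis by (simp add: power_mult_distrib right_diff_distrib)
  qed
  ultimately show ?thesis using I_diff[OF I_mult_left[OF 1, of "x ^ m"]] by (simp only:)
qed (simp add: I_0)

end

section \<open>The p-adic absolute value\<close>

locale padic_field =
  fixes p :: nat and v :: "'k::field_char_0 \<Rightarrow> real"
  assumes prime_p: "prime p" and ambient: "padic_ambient p v"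
begin

text \<open>The absolute value of \<open>p\<close> (see \<open>v_p\<close>), so that
  \<open>\<rho> ^ k\<close> measures divisibility by \<open>p ^ k\<close>.\<close>

definition \<rho> :: real where "\<rho> = inverse (real p)"

lemma p_gt_1: "p > 1" using prime_p by (rule prime_gt_1_nat)

lemma rho_pos: "0 < \<rho>" and rho_less_1: "\<rho> < 1"
  using p_gt_1 by (auto simp: \<rho>_def field_simps)

lemma rho_power_pos [simp]: "0 < \<rho> ^ n" "0 \<le> \<rho> ^ n"
  using rho_pos by (auto simp: less_imp_le)

lemma rho_power_le_1: "\<rho> ^ n \<le> 1"
  using rho_pos rho_less_1 by (simp add: power_le_one)

lemma rho_power_antimono: "m \<le> n \<Longrightarrow> \<rho> ^ n \<le> \<rho> ^ m"
  using rho_pos rho_less_1 by (intro power_decreasing) auto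

lemma rho_power_tendsto: "(\<lambda>n. \<rho> ^ n) \<longlonglongrightarrow> 0"
  using rho_pos rho_less_1 by (intro LIMSEQ_power_zero) auto

lemma rho_power_less: "e > 0 \<Longrightarrow> \<exists>n. \<rho> ^ n < e"
  using rho_less_1 real_arch_pow_inv by blast

lemma nonarch: "nonarch_abs v"
  using ambient by (simp add: padic_ambient_def)

lemma v_nonneg [simp]: "v x \<ge> 0" and v_eq_0 [simp]: "v x = 0 \<longleftrightarrow> x = 0"
  and v_mult: "v (x * y) = v x * v y" and v_add: "v (x + y) \<le> max (v x) (v y)"
  using nonarch by (auto simp: nonarch_abs_def)

lemma v_of_int: "n \<noteq> 0 \<Longrightarrow> v (of_int n) = \<rho> ^ multiplicity (int p) n"
  using ambient by (auto simp: padic_ambient_def \<rho>_def)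

lemma rational_Cauchy_convergent:
  assumes "\<And>n. f n \<in> range of_rat"
    and "\<And>e. e > 0 \<Longrightarrow> \<exists>N. \<forall>m\<ge>N. \<forall>n\<ge>N. v (f m - f n) < e"
  shows "\<exists>L. vlim v f L"
proof -
  have "(\<forall>n. f n \<in> range of_rat) \<and> (\<forall>e>0. \<exists>N. \<forall>m\<ge>N. \<forall>n\<ge>N. v (f m - f n) < e)
      \<longrightarrow> (\<exists>L. vlim v f L)"
    using ambient unfolding padic_ambient_def by (elim conjE) (erule allE[of _ f])
  then show ?thesis using assms by simp
qed

lemma v_pos [simp]: "v x > 0 \<longleftrightarrow> x \<noteq> 0"
  using v_nonneg[of x] v_eq_0[of x] by linarith

lemma v_1 [simp]: "v 1 = 1"
  using v_of_int[of 1] by simp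

lemma v_0 [simp]: "v 0 = 0" by simp

lemma v_minus [simp]: "v (- x) = v x"
proof -
  have "v (-1) ^ 2 = 1" using v_mult[of "-1" "-1"] by (simp add: power2_eq_square)
  then have "v (-1) = 1" using v_nonneg[of "-1"] by (auto simp: power2_eq_1_iff simp del: v_nonneg)
  then show ?thesis using v_mult[of "-1" x] by simp
qed

lemma v_add_sum: "v (x + y) \<le> v x + v y"
  using v_add[of x y] v_nonneg[of x] v_nonneg[of y] by linarith

lemma v_diff_commute: "v (x - y) = v (y - x)"
  using v_minus[of "x - y"] by simp

lemma v_add_le: "v x \<le> B \<Longrightarrow> v y \<le> B \<Longrightarrow> v (x + y) \<le> B"
  using v_add[of x y] by simp

lemma v_triangle_le: "v (x - y) \<le> B \<Longrightarrow> v (y - z) \<le> B \<Longrightarrow> v (x - z) \<le> B"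
  using v_add_le[of "x - y" B "y - z"] by simp

lemma v_triangle_less: "v (x - y) < B \<Longrightarrow> v (y - z) < B \<Longrightarrow> v (x - z) < B"
  using v_add[of "x - y" "y - z"] by simp

lemma v_power: "v (x ^ n) = v x ^ n"
  by (induction n) (auto simp: v_mult)

lemma v_inverse: "v (inverse x) = inverse (v x)"
proof (cases "x = 0")
  case False
  then have "v x * v (inverse x) = 1" using v_mult[of x "inverse x"] by simp
  then show ?thesis by (metis inverse_unique)
qed auto

lemma v_divide: "v (x / y) = v x / v y"
  by (simp add: divide_inverse v_mult v_inverse)

lemma v_sum_le: "B \<ge> 0 \<Longrightarrow> (\<And>i. i \<in> A \<Longrightarrow> v (f i) \<le> B) \<Longrightarrow> v (sum f A) \<le> B"
  by (induction A rule: infinite_finite_induct) (auto intro: v_add_le)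

lemma v_p: "v (of_nat p) = \<rho>"
  using v_of_int[of "int p"] p_gt_1 multiplicity_self[of "int p"] by simp

lemma v_of_int_le_1: "v (of_int n) \<le> 1"
  by (cases "n = 0") (auto simp: v_of_int rho_power_le_1)

lemma v_of_nat_le_1: "v (of_nat n) \<le> 1"
  using v_of_int_le_1[of "int n"] by simp

lemma v_of_int_not_dvd: "\<not> int p dvd n \<Longrightarrow> v (of_int n) = 1"
  by (cases "n = 0") (auto simp: v_of_int not_dvd_imp_multiplicity_0)

lemma v_of_nat_not_dvd: "\<not> p dvd n \<Longrightarrow> v (of_nat n) = 1"
  using v_of_int_not_dvd[of "int n"] by simp

lemma v_of_int_le_iff: "v (of_int n) \<le> \<rho> ^ k \<longleftrightarrow> int p ^ k dvd n"
proof (cases "n = 0")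
  case False
  have "v (of_int n) \<le> \<rho> ^ k \<longleftrightarrow> k \<le> multiplicity (int p) n"
    using False rho_pos rho_less_1 by (simp add: v_of_int power_decreasing_iff)
  also have "\<dots> \<longleftrightarrow> int p ^ k dvd n"
    using False prime_p p_gt_1 by (simp add: power_dvd_iff_le_multiplicity)
  finally show ?thesis .
qed auto

text \<open>Legendre's recursion: only the multiples of \<open>p\<close> among the factors of
  \<open>fact k\<close> have absolute value below 1, and removing one \<open>p\<close> from each of
  them leaves \<open>fact (k div p)\<close>.\<close>

lemma v_fact: "v (fact k) = \<rho> ^ (k div p) * v (fact (k div p))"
proof (induction k)
  case (Suc k)
  show ?case
  proof (cases "p dvd Suc k")
    case True
    then obtain m where m: "Suc k = p * m" by auto
    then obtain m' where m': "m = Suc m'" by (cases m) auto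
    have "Suc k div p = m" using m p_gt_1 by simp
    moreover have "k div p = m'"
    proof -
      have "k = p * m' + (p - 1)" using m m' p_gt_1 by simp
      moreover have "(p * m' + (p - 1)) div p = m'"
        using p_gt_1 by (subst div_mult_self4) auto
      ultimately show ?thesis by simp
    qed
    moreover have "v (of_nat (Suc k)) = \<rho> * v (of_nat m)"
      by (simp only: m of_nat_mult v_mult v_p)
    ultimately show ?thesis
      using Suc m' by (simp add: v_mult del: of_nat_Suc)
  next
    case False
    then have "Suc k div p = k div p" using div_Suc[of k p] by (auto simp: dvd_eq_mod_eq_0)
    moreover have "v (of_nat (Suc k)) = 1" using False by (rule v_of_nat_not_dvd)
    ultimately show ?thesis using Suc by (simp add: v_mult del: of_nat_Suc)
  qed
qed simp

text \<open>With \<open>m = k div p\<close>, the recursion and induction bound the valuation of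
  \<open>fact k\<close> by \<open>m + m\<close>, and
  \<open>2 * m \<le> p * m \<le> k\<close>.\<close>

lemma v_fact_ge: "v (fact k) \<ge> \<rho> ^ k"
proof (induction k rule: less_induct)
  case (less k)
  show ?case
  proof (cases "k = 0")
    case False
    define m where "m = k div p"
    have "m < k" using False p_gt_1 by (simp add: m_def)
    have "2 * m \<le> p * m" using p_gt_1 by simp
    also have "\<dots> \<le> k" by (simp add: m_def)
    finally have "\<rho> ^ k \<le> \<rho> ^ m * \<rho> ^ m" 
      using rho_power_antimono[of "2 * m" k] by (simp add: mult_2 power_add)
    also have "\<dots> \<le> \<rho> ^ m * v (fact m)" using less[OF \<open>m < k\<close>] by simp
    finally show ?thesis by (simp add: v_fact[of k] m_def)
  qed simp
qed

section \<open>Limits with respect to the absolute value\<close>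

lemma vlimI:
  assumes "\<And>n. n \<ge> N \<Longrightarrow> v (f n - L) \<le> g n" "g \<longlonglongrightarrow> 0"
  shows "vlim v f L"
  unfolding vlim_def
  by (rule tendsto_sandwich[OF _ _ tendsto_const assms(2)])
    (use assms(1) in \<open>auto simp: eventually_at_top_linorder\<close>)

lemma vlim_const: "vlim v (\<lambda>_. x) x"
  by (simp add: vlim_def)

lemma vlim_cong_ev:
  assumes "vlim v f L" "\<And>n. n \<ge> N \<Longrightarrow> f n = g n"
  shows "vlim v g L"
  using assms(1) unfolding vlim_def
  by (rule Lim_transform_eventually) (use assms(2) in \<open>auto simp: eventually_at_top_linorder intro!: exI[of _ N]\<close>)

lemma vlim_v:
  assumes "vlim v f L"
  shows "(\<lambda>n. v (f n)) \<longlonglongrightarrow> v L"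
proof -
  have "\<bar>v x - v y\<bar> \<le> v (x - y)" for x y
    using v_add_sum[of "x - y" y] v_add_sum[of "y - x" x] v_diff_commute[of x y] by simp
  then have "(\<lambda>n. v (f n) - v L) \<longlonglongrightarrow> 0"
    using Lim_null_comparison[OF _ assms[unfolded vlim_def], of "\<lambda>n. v (f n) - v L"] by simp
  then show ?thesis by (simp add: LIM_zero_iff)
qed

lemma vlim_v_le:
  assumes "vlim v f L" "\<And>n. n \<ge> N \<Longrightarrow> v (f n) \<le> B"
  shows "v L \<le> B"
  by (rule LIMSEQ_le_const2[OF vlim_v[OF assms(1)]]) (use assms(2) in blast)

lemma vlim_add:
  assumes "vlim v f L" "vlim v g M"
  shows "vlim v (\<lambda>n. f n + g n) (L + M)"
proof (rule vlimI[where N = 0])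
  show "v (f n + g n - (L + M)) \<le> v (f n - L) + v (g n - M)" for n
    using v_add_sum[of "f n - L" "g n - M"] by (simp add: algebra_simps)
  show "(\<lambda>n. v (f n - L) + v (g n - M)) \<longlonglongrightarrow> 0"
    using assms unfolding vlim_def by (intro tendsto_add_zero)
qed

lemma vlim_mult:
  assumes "vlim v f L" "vlim v g M"
  shows "vlim v (\<lambda>n. f n * g n) (L * M)"
proof (rule vlimI[where N = 0])
  show "v (f n * g n - L * M) \<le> v (f n - L) * v (g n) + v L * v (g n - M)" for n
  proof -
    have "f n * g n - L * M = (f n - L) * g n + L * (g n - M)" by (simp add: algebra_simps)
    then show ?thesis using v_add_sum[of "(f n - L) * g n" "L * (g n - M)"] by (simp add: v_mult)
  qed
  have "(\<lambda>n. v (f n - L) * v (g n) + v L * v (g n - M)) \<longlonglongrightarrow> 0 * v M + v L * 0"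
    using assms vlim_v[OF assms(2)] unfolding vlim_def by (intro tendsto_intros)
  then show "(\<lambda>n. v (f n - L) * v (g n) + v L * v (g n - M)) \<longlonglongrightarrow> 0" by simp
qed

lemma vlim_minus: "vlim v f L \<Longrightarrow> vlim v (\<lambda>n. - f n) (- L)"
  using vlim_mult[OF vlim_const[of "-1"], of f L] by simp

lemma vlim_diff: "vlim v f L \<Longrightarrow> vlim v g M \<Longrightarrow> vlim v (\<lambda>n. f n - g n) (L - M)"
  using vlim_add[of f L "\<lambda>n. - g n" "- M"] vlim_minus[of g M] by simp

lemma vlim_sum: "(\<And>i. i \<in> A \<Longrightarrow> vlim v (f i) (L i)) \<Longrightarrow> vlim v (\<lambda>n. \<Sum>i\<in>A. f i n) (sum L A)"
  by (induction A rule: infinite_finite_induct) (auto intro: vlim_const vlim_add)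

lemma vlim_inverse:
  assumes "vlim v f L" "L \<noteq> 0"
  shows "vlim v (\<lambda>n. inverse (f n)) (inverse L)"
proof -
  have lim: "(\<lambda>n. v (f n)) \<longlonglongrightarrow> v L" using assms(1) by (rule vlim_v)
  have pos: "v L > 0" using assms(2) by simp
  have "\<forall>\<^sub>F n in sequentially. v (f n) > 0" using order_tendstoD(1)[OF lim pos] .
  then have "\<forall>\<^sub>F n in sequentially. v (f n - L) / (v (f n) * v L) = v (inverse (f n) - inverse L)"
  proof eventually_elim
    case (elim n)
    then have nz: "f n \<noteq> 0" by auto
    then have "inverse (f n) - inverse L = (L - f n) / (f n * L)" using assms(2) by (simp add: field_simps)
    then show ?case by (simp add: v_divide v_mult v_diff_commute)
  qed
  moreover have "(\<lambda>n. v (f n - L) / (v (f n) * v L)) \<longlonglongrightarrow> 0 / (v L * v L)"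
    using pos by (intro tendsto_divide tendsto_mult tendsto_const lim assms(1)[unfolded vlim_def]) auto
  ultimately show ?thesis unfolding vlim_def by (simp add: Lim_transform_eventually)
qed

lemma vlim_unique:
  assumes "vlim v f L" "vlim v f M"
  shows "L = M"
proof -
  have "v (L - M) \<le> 0"
    using vlim_v[OF vlim_diff[OF assms]] by (simp add: LIMSEQ_const_iff)
  then show ?thesis using v_nonneg[of "L - M"] by (simp add: order_antisym)
qed

section \<open>Closures of subsets of the ambient field\<close>

definition vclosure :: "'k set \<Rightarrow> 'k set" where
  "vclosure B = {x. \<forall>e>0. \<exists>b\<in>B. v (b - x) < e}"

text \<open>The sequential form serves to transfer algebraic closure properties to limits, the form
  with \<open>e\<close> serves for approximation and for topological closedness.\<close>

lemma vclosure_eq: "vclosure B = {x. \<exists>f. (\<forall>n. f n \<in> B) \<and> vlim v f x}"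
proof (intro equalityI subsetI)
  fix x assume "x \<in> vclosure B"
  then have "\<exists>b. b \<in> B \<and> v (b - x) < \<rho> ^ n" for n unfolding vclosure_def using rho_power_pos(1) by blast
  then obtain f where f: "\<And>n. f n \<in> B" "\<And>n. v (f n - x) < \<rho> ^ n" by metis
  have "vlim v f x"
    using f(2) by (intro vlimI[where N = 0, OF _ rho_power_tendsto] less_imp_le)
  with f(1) show "x \<in> {x. \<exists>f. (\<forall>n. f n \<in> B) \<and> vlim v f x}" by blast
next
  fix x assume "x \<in> {x. \<exists>f. (\<forall>n. f n \<in> B) \<and> vlim v f x}"
  then obtain f where f: "\<forall>n. f n \<in> B" "vlim v f x" by auto
  show "x \<in> vclosure B" unfolding vclosure_def
  proof (intro CollectI allI impI)
    fix e :: real assume "e > 0"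
    with f(2) have "\<forall>\<^sub>F n in sequentially. v (f n - x) < e"
      unfolding vlim_def by (rule order_tendstoD)
    then obtain n where "v (f n - x) < e" by (auto simp: eventually_at_top_linorder)
    with f(1) show "\<exists>b\<in>B. v (b - x) < e" by blast
  qed
qed

lemma vclosure_closed:
  assumes "vlim v f L" "\<And>n. f n \<in> vclosure B"
  shows "L \<in> vclosure B"
  unfolding vclosure_def
proof (intro CollectI allI impI)
  fix e :: real assume e: "e > 0"
  with assms(1) have "\<forall>\<^sub>F n in sequentially. v (f n - L) < e"
    unfolding vlim_def by (intro order_tendstoD)
  then obtain n where "v (f n - L) < e" by (auto simp: eventually_at_top_linorder)
  moreover obtain b where "b \<in> B" "v (b - f n) < e"
    using assms(2)[of n] e by (auto simp: vclosure_def)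
  ultimately show "\<exists>b\<in>B. v (b - L) < e" using v_triangle_less by blast
qed

lemma vclosure_mono: "B \<subseteq> B' \<Longrightarrow> vclosure B \<subseteq> vclosure B'"
  unfolding vclosure_def by blast

lemma vclosure_superset: "x \<in> B \<Longrightarrow> x \<in> vclosure B"
  using vlim_const by (auto simp: vclosure_eq intro!: exI[of _ "\<lambda>_. x"])

lemma vclosure_add:
  assumes "\<And>x y. x \<in> B \<Longrightarrow> y \<in> B \<Longrightarrow> x + y \<in> B" "x \<in> vclosure B" "y \<in> vclosure B"
  shows "x + y \<in> vclosure B"
proof -
  obtain f g where "\<forall>n. f n \<in> B" "vlim v f x" "\<forall>n. g n \<in> B" "vlim v g y"
    using assms(2,3) by (auto simp: vclosure_eq)
  then show ?thesis using vlim_add[of f x g y] assms(1)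
    by (auto simp: vclosure_eq intro!: exI[of _ "\<lambda>n. f n + g n"])
qed

lemma vclosure_mult:
  assumes "\<And>x y. x \<in> B \<Longrightarrow> y \<in> B \<Longrightarrow> x * y \<in> B" "x \<in> vclosure B" "y \<in> vclosure B"
  shows "x * y \<in> vclosure B"
proof -
  obtain f g where "\<forall>n. f n \<in> B" "vlim v f x" "\<forall>n. g n \<in> B" "vlim v g y"
    using assms(2,3) by (auto simp: vclosure_eq)
  then show ?thesis using vlim_mult[of f x g y] assms(1)
    by (auto simp: vclosure_eq intro!: exI[of _ "\<lambda>n. f n * g n"])
qed

lemma vclosure_inverse:
  assumes "\<And>x. x \<in> B \<Longrightarrow> inverse x \<in> B" "x \<in> vclosure B" "x \<noteq> 0"
  shows "inverse x \<in> vclosure B"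
proof -
  obtain f where "\<forall>n. f n \<in> B" "vlim v f x"
    using assms(2) by (auto simp: vclosure_eq)
  then show ?thesis using vlim_inverse[of f x] assms(1,3)
    by (auto simp: vclosure_eq intro!: exI[of _ "\<lambda>n. inverse (f n)"])
qed

text \<open>Choosing preimages identifies such a closure with the form in which \<open>Zp\<close>
  and \<open>Qp\<close> are defined.\<close>

lemma vclosure_range: "vclosure (range h) = {x. \<exists>a. vlim v (\<lambda>n. h (a n)) x}"
proof -
  have "(\<exists>f. (\<forall>n. f n \<in> range h) \<and> vlim v f x) \<longleftrightarrow> (\<exists>a. vlim v (\<lambda>n. h (a n)) x)" for x
  proof
    assume "\<exists>f. (\<forall>n. f n \<in> range h) \<and> vlim v f x"
    then obtain f where f: "\<forall>n. \<exists>a. f n = h a" "vlim v f x" by blast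
    from choice[OF f(1)] obtain a where "\<forall>n. f n = h (a n)" ..
    then have "f = (\<lambda>n. h (a n))" by blast
    with f(2) have "vlim v (\<lambda>n. h (a n)) x" by (simp only:)
    then show "\<exists>a. vlim v (\<lambda>n. h (a n)) x" by blast
  next
    assume "\<exists>a. vlim v (\<lambda>n. h (a n)) x"
    then obtain a where "vlim v (\<lambda>n. h (a n)) x" by blast
    then show "\<exists>f. (\<forall>n. f n \<in> range h) \<and> vlim v f x"
      by (intro exI[of _ "\<lambda>n. h (a n)"]) simp
  qed
  then show ?thesis by (simp only: vclosure_eq)
qed

section \<open>The p-adic integers and the p-adic numbers\<close>

lemma Zp_eq_vclosure: "Zp v = vclosure (range of_int)"
  by (simp only: Zp_def vclosure_range)

lemma Qp_eq_vclosure: "Qp v = vclosure (range of_rat)"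
  by (simp only: Qp_def vclosure_range)

lemma Qp_closed: "vlim v f L \<Longrightarrow> (\<And>n. f n \<in> Qp v) \<Longrightarrow> L \<in> Qp v"
  using vclosure_closed by (simp add: Qp_eq_vclosure)

lemma Zp_subset_Qp: "Zp v \<subseteq> Qp v"
  unfolding Zp_eq_vclosure Qp_eq_vclosure
  proof (rule vclosure_mono, rule image_subsetI)
  show "of_int n \<in> range of_rat" for n
    using rangeI[of of_rat "of_int n"] by simp
qed

lemma Zp_of_int [simp]: "of_int n \<in> Zp v"
  by (simp add: Zp_eq_vclosure vclosure_superset)

lemma Zp_of_nat [simp]: "of_nat n \<in> Zp v"
  using Zp_of_int[of "int n"] by simp

lemma Zp_0 [simp]: "0 \<in> Zp v" and Zp_1 [simp]: "1 \<in> Zp v"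
  using Zp_of_int[of 0] Zp_of_int[of 1] by simp_all

lemma Zp_add: "x \<in> Zp v \<Longrightarrow> y \<in> Zp v \<Longrightarrow> x + y \<in> Zp v"
  unfolding Zp_eq_vclosure by (rule vclosure_add) (auto simp flip: of_int_add)

lemma Zp_mult: "x \<in> Zp v \<Longrightarrow> y \<in> Zp v \<Longrightarrow> x * y \<in> Zp v"
  unfolding Zp_eq_vclosure by (rule vclosure_mult) (auto simp flip: of_int_mult)

lemma Zp_minus: "x \<in> Zp v \<Longrightarrow> - x \<in> Zp v"
  using Zp_mult[of "-1" x] Zp_of_int[of "-1"] by simp

lemma Zp_diff: "x \<in> Zp v \<Longrightarrow> y \<in> Zp v \<Longrightarrow> x - y \<in> Zp v"
  using Zp_add[of x "- y"] Zp_minus[of y] by simp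

lemma Zp_v_le_1: "x \<in> Zp v \<Longrightarrow> v x \<le> 1"
  unfolding Zp_def by (auto intro: vlim_v_le v_of_int_le_1)

lemma subfield_Qp: "subfield_of (Qp v)"
proof -
  have add: "x + y \<in> Qp v" if "x \<in> Qp v" "y \<in> Qp v" for x y
    using _ that unfolding Qp_eq_vclosure by (rule vclosure_add) (auto simp flip: of_rat_add)
  have mult: "x * y \<in> Qp v" if "x \<in> Qp v" "y \<in> Qp v" for x y
    using _ that unfolding Qp_eq_vclosure by (rule vclosure_mult) (auto simp flip: of_rat_mult)
  have inv: "inverse x \<in> Qp v" if "x \<in> Qp v" for x
  proof (cases "x = 0")
    case False
    with _ that show ?thesis unfolding Qp_eq_vclosure
      by (rule vclosure_inverse) (auto simp flip: of_rat_inverse)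
  qed (use that in simp)
  have int: "of_int n \<in> Qp v" for n using Zp_subset_Qp by auto
  have "- x \<in> Qp v" if "x \<in> Qp v" for x
    using mult[OF int[of "-1"] that] by simp
  then show ?thesis using add mult inv int[of 0] int[of 1] by (auto simp: subfield_of_def)
qed

lemma Qp_add: "x \<in> Qp v \<Longrightarrow> y \<in> Qp v \<Longrightarrow> x + y \<in> Qp v"
  and Qp_mult: "x \<in> Qp v \<Longrightarrow> y \<in> Qp v \<Longrightarrow> x * y \<in> Qp v"
  and Qp_inverse: "x \<in> Qp v \<Longrightarrow> inverse x \<in> Qp v"
  and Qp_0 [simp]: "0 \<in> Qp v"
  using subfield_Qp by (auto simp: subfield_of_def)

lemma Qp_sum: "(\<And>i. i \<in> A \<Longrightarrow> f i \<in> Qp v) \<Longrightarrow> sum f A \<in> Qp v"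
  by (induction A rule: infinite_finite_induct) (auto simp: Qp_add)

lemma finite_ext_Qp_Qp: "finite_ext_Qp v (Qp v)"
  unfolding finite_ext_Qp_def
proof (intro conjI exI[of _ 1] exI[of _ "\<lambda>_. 1"])
  show "Qp v \<subseteq> {\<Sum>i<1. c i * 1 | c. \<forall>i<1::nat. c i \<in> Qp v}"
  proof
    fix x assume "x \<in> Qp v"
    then show "x \<in> {\<Sum>i<1. c i * 1 | c. \<forall>i<1::nat. c i \<in> Qp v}"
      by (intro CollectI exI[of _ "\<lambda>_. x"]) auto
  qed
qed (use subfield_Qp in \<open>auto simp: subfield_of_def\<close>)

text \<open>\<open>padic_ambient\<close> grants limits only to Cauchy sequences of rationals, so
  \<open>f n\<close> is replaced by a rational within \<open>\<rho> ^ n\<close>. By the ultrametric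
  inequality the step errors do not accumulate, so the bound \<open>\<rho> ^ n\<close> persists in
  the limit.\<close>

lemma Qp_geometric_limit:
  assumes Q: "\<And>n. f n \<in> Qp v" and step: "\<And>n. v (f (Suc n) - f n) \<le> \<rho> ^ n"
  shows "\<exists>L\<in>Qp v. vlim v f L \<and> (\<forall>n. v (L - f n) \<le> \<rho> ^ n)"
proof -
  have far: "v (f (n + k) - f n) \<le> \<rho> ^ n" for n k
  proof (induction k)
    case (Suc k)
    have "v (f (Suc (n + k)) - f (n + k)) \<le> \<rho> ^ n"
      using step[of "n + k"] rho_power_antimono[of n "n + k"] by simp
    then show ?case using v_triangle_le[OF _ Suc] by simp
  qed simp
  have far': "v (f m - f n) \<le> \<rho> ^ N" if "m \<ge> N" "n \<ge> N" for m n N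
    using v_triangle_le[of "f m" "f N" "\<rho> ^ N" "f n"] far[of N "m - N"] far[of N "n - N"] that
    by (simp add: v_diff_commute)
  have "\<exists>b. v (of_rat b - f n) < \<rho> ^ n" for n
    using Q[of n] rho_power_pos(1)[of n] unfolding Qp_eq_vclosure vclosure_def by blast
  then obtain b where b: "v (of_rat (b n) - f n) < \<rho> ^ n" for n by metis
  have "\<exists>L. vlim v (\<lambda>n. of_rat (b n)) L"
  proof -
    have "\<exists>N. \<forall>m\<ge>N. \<forall>n\<ge>N. v (of_rat (b m) - of_rat (b n)) < e" if e: "e > 0" for e
    proof -
      obtain N where N: "\<rho> ^ N < e" using rho_power_less[OF e] ..
      have "v (of_rat (b m) - of_rat (b n)) < e" if "m \<ge> N" "n \<ge> N" for m n
      proof (rule le_less_trans[OF v_triangle_le[OF _ v_triangle_le[OF far'[OF that]]] N])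
        show "v (of_rat (b m) - f m) \<le> \<rho> ^ N"
          using b[of m] rho_power_antimono[OF that(1)] by linarith
        show "v (f n - of_rat (b n)) \<le> \<rho> ^ N"
          using b[of n] rho_power_antimono[OF that(2)] by (simp add: v_diff_commute)
      qed
      then show ?thesis by blast
    qed
    then show ?thesis by (intro rational_Cauchy_convergent) auto
  qed
  then obtain L where L: "vlim v (\<lambda>n. of_rat (b n)) L" ..
  have "vlim v (\<lambda>n. f n - of_rat (b n)) 0"
    by (rule vlimI[where N = 0, OF _ rho_power_tendsto]) (use b in \<open>simp add: v_diff_commute less_imp_le\<close>)
  from vlim_add[OF this L] have lim: "vlim v f L" by simp
  moreover have "v (L - f n) \<le> \<rho> ^ n" for n
    using vlim_diff[OF lim vlim_const] by (rule vlim_v_le[where N = n]) (use far' in simp)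
  moreover have "L \<in> Qp v" using Qp_closed[OF lim Q] .
  ultimately show ?thesis by blast
qed

text \<open>An integer close enough to \<open>x\<close> is itself divisible by \<open>p ^ k\<close>,
  and its quotient approximates the quotient of \<open>x\<close>.\<close>

lemma Zp_divide_p_power:
  assumes "x \<in> Zp v" "v x \<le> \<rho> ^ k"
  shows "x / of_nat p ^ k \<in> Zp v"
  unfolding Zp_eq_vclosure vclosure_def
proof (intro CollectI allI impI)
  fix e :: real assume e: "e > 0"
  have pk: "v (of_nat p ^ k) = \<rho> ^ k" by (simp add: v_power v_p)
  \<comment> \<open>The radius \<open>e * \<rho> ^ k\<close> leaves precision \<open>e\<close> after
    division by \<open>p ^ k\<close>; the radius \<open>\<rho> ^ k\<close> forces
    divisibility.\<close>
  have "min (e * \<rho> ^ k) (\<rho> ^ k) > 0" using e by simp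
  then obtain a :: int where a: "v (of_int a - x) < min (e * \<rho> ^ k) (\<rho> ^ k)"
    using assms(1) unfolding Zp_eq_vclosure vclosure_def by blast
  then have "v (of_int a) \<le> \<rho> ^ k" using v_add_le[of "of_int a - x" "\<rho> ^ k" x] assms(2) by simp
  then obtain b where "a = int p ^ k * b" by (auto simp: v_of_int_le_iff)
  then have "of_int b - x / of_nat p ^ k = (of_int a - x) / of_nat p ^ k"
    using p_gt_1 by (simp add: field_simps)
  then have "v (of_int b - x / of_nat p ^ k) < e"
    using a by (simp add: v_divide pk pos_divide_less_eq)
  then show "\<exists>b\<in>range of_int. v (b - x / of_nat p ^ k) < e" by blast
qed

text \<open>An approximating integer is reduced modulo \<open>p ^ k\<close>. The closeness gives
  density of the naturals; the bound \<open>n < p ^ k\<close> serves, for \<open>k = 1\<close>, to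
  count residues in a pigeonhole argument.\<close>

lemma Zp_approx_nat:
  assumes "x \<in> Zp v"
  shows "\<exists>n < p ^ k. v (of_nat n - x) \<le> \<rho> ^ k"
proof -
  obtain a :: int where a: "v (of_int a - x) < \<rho> ^ k"
    using assms rho_power_pos(1)[of k] unfolding Zp_eq_vclosure vclosure_def by blast
  define n where "n = nat (a mod int p ^ k)"
  have n: "int n = a mod int p ^ k" using p_gt_1 by (simp add: n_def)
  also have "\<dots> < int p ^ k" using p_gt_1 by simp
  finally have "n < p ^ k" by (metis of_nat_less_iff of_nat_power)
  have "int p ^ k dvd int n - a" unfolding n by (simp add: mod_eq_dvd_iff[symmetric])
  then have "v (of_int (int n - a)) \<le> \<rho> ^ k" by (simp only: v_of_int_le_iff)
  then have "v (of_nat n - x) \<le> \<rho> ^ k"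
    using a v_triangle_le[of "of_nat n" "of_int a" "\<rho> ^ k" x] by simp
  with \<open>n < p ^ k\<close> show ?thesis by blast
qed

text \<open>Inverses of \<open>n\<close> modulo \<open>p ^ k\<close>, supplied by Bezout, are
  integers converging to the inverse.\<close>

lemma Zp_inverse_of_nat:
  assumes "\<not> p dvd n"
  shows "inverse (of_nat n) \<in> Zp v"
  unfolding Zp_eq_vclosure vclosure_def
proof (intro CollectI allI impI)
  fix e :: real assume "e > 0"
  then obtain k where k: "\<rho> ^ k < e" using rho_power_less by blast
  have "coprime (int n) (int p ^ k)"
    using prime_p assms by (metis coprime_commute coprime_int_iff coprime_power_right_iff prime_imp_coprime)
  then obtain b w where "b * int n + w * int p ^ k = 1"
    using bezout_int[of "int n" "int p ^ k"] by auto
  then have "int n * b - 1 = int p ^ k * (- w)" by (simp add: algebra_simps)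
  then have "v (of_int (int n * b - 1)) \<le> \<rho> ^ k"
    unfolding v_of_int_le_iff by (metis dvd_triv_left)
  moreover have vn: "v (of_nat n) = 1" using v_of_nat_not_dvd[OF assms] .
  moreover have "of_nat n * (of_int b - inverse (of_nat n)) = (of_int (int n * b - 1) :: 'k)"
    using vn by (cases "n = 0") (auto simp: algebra_simps)
  ultimately have "v (of_int b - inverse (of_nat n)) \<le> \<rho> ^ k"
    using v_mult[of "of_nat n" "of_int b - inverse (of_nat n)"] by simp
  with k show "\<exists>b\<in>range of_int. v (b - inverse (of_nat n)) < e"
    by (intro bexI[of _ "of_int b"]) auto
qed

section \<open>Newton series\<close>

text \<open>The coefficient \<open>g d\<close> is the sum over \<open>k\<close> of the
  \<open>d\<close>-th coefficients of \<open>Q k\<close>. The bound \<open>\<rho> ^ k\<close> is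
  uniform in \<open>d\<close>, so every tail from \<open>N\<close> on is at most
  \<open>\<rho> ^ N\<close>.\<close>

lemma power_series_rearrangement:
  assumes deg: "\<And>k. degree (Q k) \<le> k"
    and Qp: "\<And>k d. coeff (Q k) d \<in> Qp v" and bound: "\<And>k d. v (coeff (Q k) d) \<le> \<rho> ^ k"
  shows "\<exists>g. (\<forall>d. g d \<in> Qp v) \<and> (\<forall>x L. v x \<le> 1 \<longrightarrow>
    vlim v (\<lambda>N. \<Sum>k<N. poly (Q k) x) L \<longrightarrow> vlim v (\<lambda>N. \<Sum>d<N. g d * x ^ d) L)"
proof -
  have "\<exists>g\<in>Qp v. \<forall>N. v (g - (\<Sum>k<N. coeff (Q k) d)) \<le> \<rho> ^ N" for d
    using Qp_geometric_limit[of "\<lambda>N. \<Sum>k<N. coeff (Q k) d"] by (auto simp: Qp_sum Qp bound)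
  then obtain g where gQ: "\<And>d. g d \<in> Qp v"
    and g: "\<And>d N. v (g d - (\<Sum>k<N. coeff (Q k) d)) \<le> \<rho> ^ N" by metis
  have "vlim v (\<lambda>N. \<Sum>d<N. g d * x ^ d) L"
    if x: "v x \<le> 1" and L: "vlim v (\<lambda>N. \<Sum>k<N. poly (Q k) x) L" for x L
  proof -
    have "v ((\<Sum>d<N. g d * x ^ d) - (\<Sum>k<N. poly (Q k) x)) \<le> \<rho> ^ N" for N
    proof -
      \<comment> \<open>For \<open>k < N\<close> the degree bound confines \<open>Q k\<close> to
        exponents below \<open>N\<close>, so the two truncations at \<open>N\<close> differ only by
        tails of coefficient sums.\<close>
      have "poly (Q k) x = (\<Sum>d<N. coeff (Q k) d * x ^ d)" if "k < N" for k
        unfolding poly_altdef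
        by (rule sum.mono_neutral_left) (use that deg[of k] in \<open>auto intro: coeff_eq_0 le_less_trans\<close>)
      then have "(\<Sum>k<N. poly (Q k) x) = (\<Sum>k<N. \<Sum>d<N. coeff (Q k) d * x ^ d)" by simp
      also have "\<dots> = (\<Sum>d<N. (\<Sum>k<N. coeff (Q k) d) * x ^ d)"
        by (subst sum.swap) (simp add: sum_distrib_right)
      finally have "(\<Sum>d<N. g d * x ^ d) - (\<Sum>k<N. poly (Q k) x) =
          (\<Sum>d<N. (g d - (\<Sum>k<N. coeff (Q k) d)) * x ^ d)"
        by (simp add: sum_subtractf left_diff_distrib)
      also have "v \<dots> \<le> \<rho> ^ N"
      proof (rule v_sum_le)
        fix d
        have "v (x ^ d) \<le> 1" using x by (simp add: v_power power_le_one)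
        then show "v ((g d - (\<Sum>k<N. coeff (Q k) d)) * x ^ d) \<le> \<rho> ^ N"
          using mult_mono[OF g[of d N], of "v (x ^ d)" 1] by (simp add: v_mult)
      qed simp
      finally show ?thesis .
    qed
    then have "vlim v (\<lambda>N. (\<Sum>d<N. g d * x ^ d) - (\<Sum>k<N. poly (Q k) x)) 0"
      by (intro vlimI[where N = 0, OF _ rho_power_tendsto]) simp
    from vlim_add[OF this L] show ?thesis by simp
  qed
  with gQ show ?thesis by blast
qed

lemma Zp_falling_factorial: "y \<in> Zp v \<Longrightarrow> (\<Prod>i=0..<k. y - of_nat i) \<in> Zp v"
  by (induction k) (auto simp: Zp_mult Zp_diff)

text \<open>Falling factorials are integral on \<open>Zp v\<close>; the Lipschitz constant 1
  propagates through products by the discrete product rule.\<close>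

lemma v_falling_factorial_diff_le:
  assumes "x \<in> Zp v" "y \<in> Zp v"
  shows "v ((\<Prod>i=0..<k. x - of_nat i) - (\<Prod>i=0..<k. y - of_nat i)) \<le> v (x - y)"
proof (induction k)
  case (Suc k)
  define f where "f x = (\<Prod>i=0..<k. x - of_nat i)" for x :: 'k
  have "v (f x - f y) * v (x - of_nat k) \<le> v (x - y) * 1"
    using Suc Zp_v_le_1[OF Zp_diff[OF assms(1) Zp_of_nat[of k]]]
    unfolding f_def by (intro mult_mono) auto
  moreover have "v (f y) * v (x - y) \<le> 1 * v (x - y)"
    using Zp_v_le_1[OF Zp_falling_factorial[OF assms(2)]] unfolding f_def by (intro mult_right_mono) auto
  ultimately have "v ((f x - f y) * (x - of_nat k) + f y * (x - y)) \<le> v (x - y)"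
    by (intro v_add_le) (auto simp: v_mult)
  moreover have "(f x - f y) * (x - of_nat k) + f y * (x - y) =
      f x * (x - of_nat k) - f y * (y - of_nat k)"
    by (simp add: algebra_simps)
  ultimately show ?case by (simp add: f_def)
qed simp

text \<open>The definite description is meaningful only where the Newton series converges, as it
  does at naturals for every \<open>c\<close> and on all of \<open>Zp v\<close> under the bounds on
  \<open>c\<close> fixed below.\<close>

definition newton_sum :: "(nat \<Rightarrow> 'k) \<Rightarrow> 'k \<Rightarrow> 'k" where
  "newton_sum c y = (THE L. vlim v (\<lambda>N. \<Sum>k<N. c k * (y gchoose k)) L)"

lemma newton_sum_eqI:
  "vlim v (\<lambda>N. \<Sum>k<N. c k * (y gchoose k)) L \<Longrightarrow> newton_sum c y = L"
  unfolding newton_sum_def by (rule the_equality) (auto intro: vlim_unique)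

text \<open>At a natural \<open>m\<close> the binomial coefficients with \<open>k > m\<close>
  vanish, so the partial sums are eventually constant.\<close>

lemma newton_sum_of_nat: "newton_sum c (of_nat m) = (\<Sum>k\<le>m. of_nat (m choose k) * c k)"
proof (rule newton_sum_eqI)
  have "(\<Sum>k<N. c k * (of_nat m gchoose k)) = (\<Sum>k\<le>m. of_nat (m choose k) * c k)" if "N \<ge> Suc m" for N
    by (rule sum.mono_neutral_cong_right)
      (use that in \<open>auto simp: binomial_eq_0 mult.commute simp flip: binomial_gbinomial\<close>)
  then show "vlim v (\<lambda>N. \<Sum>k<N. c k * (of_nat m gchoose k)) (\<Sum>k\<le>m. of_nat (m choose k) * c k)"
    by (intro vlim_cong_ev[OF vlim_const, of "Suc m"]) simp
qed

context
  fixes c :: "nat \<Rightarrow> 'k"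
  assumes c_Qp: "\<And>k. c k \<in> Qp v" and c_bound: "\<And>k. v (c k) \<le> \<rho> ^ (2 * k)"
begin

text \<open>Of the factor \<open>p ^ (2 * k)\<close> in \<open>c k\<close>, one half absorbs
  \<open>fact k\<close> and the other half remains for convergence.\<close>

lemma v_divide_fact_le: "v (c k / fact k) \<le> \<rho> ^ k"
proof -
  have "v (c k) \<le> \<rho> ^ k * \<rho> ^ k" using c_bound[of k] by (simp add: mult_2 power_add)
  also have "\<dots> \<le> \<rho> ^ k * v (fact k)" using v_fact_ge[of k] by simp
  finally show ?thesis by (simp add: v_divide divide_le_eq)
qed

lemma divide_fact_Qp: "c k / fact k \<in> Qp v"
proof -
  have "fact k \<in> Qp v" using Zp_of_nat[of "fact k"] Zp_subset_Qp by auto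
  then show ?thesis by (simp add: divide_inverse Qp_mult Qp_inverse c_Qp)
qed

lemma newton_term: "c k * (y gchoose k) = c k / fact k * (\<Prod>i=0..<k. y - of_nat i)"
  by (simp add: gbinomial_prod_rev)

lemma newton_term_le:
  assumes "y \<in> Zp v"
  shows "v (c k * (y gchoose k)) \<le> \<rho> ^ k"
  using mult_mono[OF v_divide_fact_le[of k] Zp_v_le_1[OF Zp_falling_factorial[OF assms, of k]]]
  unfolding newton_term v_mult by simp

lemma newton_sum_vlim:
  assumes y: "y \<in> Zp v"
  shows "vlim v (\<lambda>N. \<Sum>k<N. c k * (y gchoose k)) (newton_sum c y)" and "newton_sum c y \<in> Qp v"
proof -
  have "c k * (y gchoose k) \<in> Qp v" for k
    unfolding newton_term using Zp_falling_factorial[OF y] Zp_subset_Qp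
    by (intro Qp_mult divide_fact_Qp) auto
  then obtain L where L: "L \<in> Qp v" "vlim v (\<lambda>N. \<Sum>k<N. c k * (y gchoose k)) L"
    using Qp_geometric_limit[of "\<lambda>N. \<Sum>k<N. c k * (y gchoose k)"] newton_term_le[OF y]
    by (auto simp: Qp_sum)
  moreover have "newton_sum c y = L" using L(2) by (rule newton_sum_eqI)
  ultimately show "vlim v (\<lambda>N. \<Sum>k<N. c k * (y gchoose k)) (newton_sum c y)" "newton_sum c y \<in> Qp v"
    by auto
qed

text \<open>Each term is an element of absolute value at most 1 times a falling factorial, so
  partial sums have Lipschitz constant 1, and this passes to the limit.\<close>

lemma newton_sum_lipschitz:
  assumes x: "x \<in> Zp v" and y: "y \<in> Zp v"
  shows "v (newton_sum c x - newton_sum c y) \<le> v (x - y)"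
proof (rule vlim_v_le[OF vlim_diff[OF newton_sum_vlim(1)[OF x] newton_sum_vlim(1)[OF y]]])
  fix N
  have "v (\<Sum>k<N. c k * (x gchoose k) - c k * (y gchoose k)) \<le> v (x - y)"
  proof (rule v_sum_le)
    fix k
    have "c k * (x gchoose k) - c k * (y gchoose k) =
        c k / fact k * ((\<Prod>i=0..<k. x - of_nat i) - (\<Prod>i=0..<k. y - of_nat i))"
      by (simp only: newton_term right_diff_distrib)
    moreover have "v (c k / fact k) \<le> 1" using v_divide_fact_le[of k] rho_power_le_1[of k] by linarith
    ultimately show "v (c k * (x gchoose k) - c k * (y gchoose k)) \<le> v (x - y)"
      using mult_mono[OF _ v_falling_factorial_diff_le[OF x y, of k], of "v (c k / fact k)" 1]
      by (simp only: v_mult v_nonneg mult_1 zero_le_one)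
  qed simp
  then show "v ((\<Sum>k<N. c k * (x gchoose k)) - (\<Sum>k<N. c k * (y gchoose k))) \<le> v (x - y)"
    by (simp add: sum_subtractf)
qed

text \<open>The falling factorials of \<open>a + b * x\<close>, as polynomials \<open>R k\<close> in
  \<open>x\<close>, still have integral coefficients, so the bound on \<open>c k / fact k\<close>
  bounds all coefficients of the terms and the series can be rearranged.\<close>

lemma newton_sum_affine_power_series:
  assumes a: "a \<in> Zp v" and b: "b \<in> Zp v"
  shows "\<exists>g. (\<forall>d. g d \<in> Qp v) \<and>
    (\<forall>x\<in>Zp v. vlim v (\<lambda>N. \<Sum>d<N. g d * x ^ d) (newton_sum c (a + b * x)))"
proof -
  define R where "R k = (\<Prod>i=0..<k. [:a - of_nat i, b:])" for k
  define Q where "Q k = smult (c k / fact k) (R k)" for k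
  have R: "coeff (R k) d \<in> Zp v" for k d
  proof (induction k arbitrary: d)
    case 0
    then show ?case by (simp add: R_def coeff_1)
  next
    case (Suc k)
    have "R (Suc k) = [:a - of_nat k, b:] * R k" by (simp add: R_def mult.commute)
    then show ?case using Suc a b
      by (cases d) (auto simp: Zp_add Zp_mult Zp_diff)
  qed
  have degR: "degree (R k) \<le> k" for k
  proof (induction k)
    case (Suc k)
    have "R (Suc k) = R k * [:a - of_nat k, b:]" by (simp add: R_def)
    then have "degree (R (Suc k)) \<le> degree (R k) + degree [:a - of_nat k, b:]"
      by (simp only: degree_mult_le)
    also have "\<dots> \<le> k + 1" using Suc by (intro add_mono) auto
    finally show ?case by simp
  qed (simp add: R_def)
  have Qx: "poly (Q k) x = c k * ((a + b * x) gchoose k)" for k x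
    unfolding newton_term Q_def R_def by (simp add: poly_prod algebra_simps)
  have "degree (Q k) \<le> k" for k using degR[of k] degree_smult_le[of _ "R k"] unfolding Q_def by (meson le_trans)
  moreover have "coeff (Q k) d \<in> Qp v" for k d
    unfolding Q_def using R Zp_subset_Qp by (auto intro!: Qp_mult divide_fact_Qp simp del: times_divide_eq_left)
  moreover have "v (coeff (Q k) d) \<le> \<rho> ^ k" for k d
    using mult_mono[OF v_divide_fact_le[of k] Zp_v_le_1[OF R[of k d]]] by (simp add: Q_def v_mult v_divide)
  ultimately obtain g where "\<forall>d. g d \<in> Qp v" and g: "\<And>x L. v x \<le> 1 \<Longrightarrow>
      vlim v (\<lambda>N. \<Sum>k<N. poly (Q k) x) L \<Longrightarrow> vlim v (\<lambda>N. \<Sum>d<N. g d * x ^ d) L"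
    using power_series_rearrangement[of Q] by blast
  moreover have "vlim v (\<lambda>N. \<Sum>d<N. g d * x ^ d) (newton_sum c (a + b * x))" if "x \<in> Zp v" for x
    using that a b newton_sum_vlim(1)[of "a + b * x"] by (intro g) (simp_all add: Zp_v_le_1 Qx Zp_add Zp_mult)
  ultimately show ?thesis by blast
qed

end

section \<open>Residue classes modulo T and cosets of p-powers\<close>

lemma of_nat_mod_div: "(of_nat i :: 'k) = of_nat (i mod q) + of_nat q * of_nat (i div q)"
  by (metis mod_mult_div_eq of_nat_add of_nat_mult)

text \<open>Explicit change of variable, from \<open>T / T' = p ^ e\<close>. It yields the equality
  of cosets and, later, the coordinate in which the interpolants are analytic.\<close>

lemma coset_reparametrization:
  assumes T: "T = p ^ e * T'" and T': "\<not> p dvd T'"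
  shows "of_nat (i mod p ^ e) + of_nat (p ^ e) * y =
    (of_nat i + of_nat T * (inverse (of_nat T') * (y - of_nat (i div p ^ e))) :: 'k)"
proof -
  have "T' \<noteq> 0" using T' by (intro notI) simp
  then have "of_nat T * inverse (of_nat T') = (of_nat (p ^ e) :: 'k)"
    by (simp add: T)
  then have "of_nat T * (inverse (of_nat T') * z) = (of_nat (p ^ e) * z :: 'k)" for z
    by (simp only: mult.assoc[symmetric])
  then show ?thesis
    unfolding of_nat_mod_div[of i "p ^ e"]
    by (simp only: right_diff_distrib) simp
qed

text \<open>The cofactor \<open>T'\<close> is a unit of \<open>Zp v\<close>, so \<open>T\<close> and
  \<open>p ^ e\<close> have the same multiples there.\<close>

lemma coset_Zp_eq:
  assumes T: "T = p ^ e * T'" and T': "\<not> p dvd T'"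
  shows "coset_Zp v (i mod p ^ e) (p ^ e) = {of_nat i + of_nat T * y | y. y \<in> Zp v}"
proof -
  have "\<exists>y'\<in>Zp v. of_nat (i mod p ^ e) + of_nat (p ^ e) * y = of_nat i + of_nat T * y'"
    if "y \<in> Zp v" for y
    unfolding coset_reparametrization[OF T T'] using that
    by (blast intro: Zp_mult Zp_diff Zp_inverse_of_nat[OF T'] Zp_of_nat)
  moreover have "\<exists>y'\<in>Zp v. of_nat i + of_nat T * y = of_nat (i mod p ^ e) + of_nat (p ^ e) * y'"
    if "y \<in> Zp v" for y
    unfolding of_nat_mod_div[of i "p ^ e"]
    by (rule bexI[of _ "of_nat (i div p ^ e) + of_nat T' * y"])
      (use that in \<open>simp_all add: T algebra_simps Zp_mult Zp_add\<close>)
  ultimately show ?thesis unfolding coset_Zp_def by fastforce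
qed

text \<open>If a natural \<open>m\<close> approximates \<open>y\<close>, then
  \<open>i + T * m\<close> approximates the point with parameter \<open>y\<close>, as multiplication
  by \<open>T\<close> does not increase absolute values. It stays in the class because
  \<open>i < T\<close>.\<close>

lemma dense_residue_class:
  assumes T: "T = p ^ e * T'" and T': "\<not> p dvd T'" and i: "i < T"
  shows "dense_in_Zp v {n. n mod T = i} (coset_Zp v (i mod p ^ e) (p ^ e))"
  unfolding dense_in_Zp_def coset_Zp_eq[OF T T']
proof (intro conjI ballI allI impI)
  show "of_nat ` {n. n mod T = i} \<subseteq> {of_nat i + of_nat T * y |y. y \<in> Zp v}"
  proof (intro image_subsetI CollectI)
    fix n assume "n \<in> {n. n mod T = i}"
    then have "n = i + T * (n div T)" by (metis CollectD mod_mult_div_eq)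
    then have "of_nat n = (of_nat i + of_nat T * of_nat (n div T) :: 'k)" by (metis of_nat_add of_nat_mult)
    then show "\<exists>y. of_nat n = of_nat i + of_nat T * y \<and> y \<in> Zp v" by (meson Zp_of_nat)
  qed
next
  fix x and \<epsilon> :: real
  assume "x \<in> {of_nat i + of_nat T * y |y. y \<in> Zp v}" and \<epsilon>: "\<epsilon> > 0"
  then obtain y where y: "y \<in> Zp v" "x = of_nat i + of_nat T * y" by blast
  obtain k where k: "\<rho> ^ k < \<epsilon>" using rho_power_less[OF \<epsilon>] ..
  obtain m where m: "v (of_nat m - y) \<le> \<rho> ^ k" using Zp_approx_nat[OF y(1)] by blast
  have "of_nat (i + T * m) - x = of_nat T * (of_nat m - y)" by (simp add: y algebra_simps)
  then have "v (of_nat (i + T * m) - x) \<le> 1 * \<rho> ^ k"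
    unfolding v_mult using m v_of_nat_le_1[of T] by (simp only: v_mult mult_mono v_nonneg)
  with k i show "\<exists>n\<in>{n. n mod T = i}. v (of_nat n - x) < \<epsilon>"
    by (intro bexI[of _ "i + T * m"]) auto
qed

end

section \<open>Polynomials in the shift acting on solutions\<close>

text \<open>Makes sequences a module over \<open>int poly\<close>, the variable acting as the shift.
  The operators of the proof thus live in a commutative ring, as the locale
  \<open>filtration\<close> requires.\<close>

definition shift_act :: "int poly \<Rightarrow> (nat \<Rightarrow> 'a::comm_ring_1) \<Rightarrow> nat \<Rightarrow> 'a" where
  "shift_act F s n = (\<Sum>i\<le>degree F. of_int (coeff F i) * s (n + i))"

lemma shift_act_0 [simp]: "shift_act 0 s n = 0"
  by (simp add: shift_act_def)

lemma shift_act_pCons [simp]: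
  "shift_act (pCons a F) s n = of_int a * s n + shift_act F s (Suc n)"
proof (cases "F = 0")
  case False
  then have "degree (pCons a F) = Suc (degree F)" by simp
  then show ?thesis unfolding shift_act_def
    by (simp only: sum.atMost_Suc_shift) simp
qed (simp add: shift_act_def)

lemma shift_act_1 [simp]: "shift_act 1 s n = s n"
  by (simp add: one_pCons)

lemma shift_act_add: "shift_act (F + G) s n = shift_act F s n + shift_act G s n"
  by (induction F G arbitrary: n rule: poly_induct2) (simp_all add: algebra_simps)

lemma shift_act_smult: "shift_act (smult c F) s n = of_int c * shift_act F s n"
  by (induction F arbitrary: n) (simp_all add: algebra_simps)

lemma shift_act_diff: "shift_act (F - G) s n = shift_act F s n - shift_act G s n"
  using shift_act_add[of "F - G" G s n] by simp

lemma shift_act_sum: "shift_act (sum F A) s n = (\<Sum>i\<in>A. shift_act (F i) s n)"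
  by (induction A rule: infinite_finite_induct) (auto simp: shift_act_add)

lemma shift_act_mult: "shift_act (F * G) s n = shift_act F (shift_act G s) n"
  by (induction F arbitrary: n) (simp_all add: shift_act_add shift_act_smult)

lemma shift_act_of_nat: "shift_act (of_nat m) s n = of_nat m * s n"
  by (simp add: of_nat_poly)

lemma shift_act_scale: "shift_act F (\<lambda>n. c * s n) n = c * shift_act F s n"
  by (simp add: shift_act_def sum_distrib_left mult_ac)

lemma shift_act_monom: "shift_act (monom 1 j) s n = s (n + j)"
  by (induction j arbitrary: n) (simp_all add: monom_0 monom_Suc)

section \<open>The lattice of integral solutions and its shift operators\<close>

locale padic_recurrence = padic_field p v for p and v :: "'k::field_char_0 \<Rightarrow> real" +
  fixes l :: nat and a :: "nat \<Rightarrow> 'k"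
  assumes a_Zp: "i < l \<Longrightarrow> a i \<in> Zp v"
begin

definition sol :: "(nat \<Rightarrow> 'k) set" where
  "sol = {s. (\<forall>n. s n \<in> Zp v) \<and> (\<forall>n. s (n + l) + (\<Sum>i<l. a i * s (n + i)) = 0)}"

lemma sol_Zp: "s \<in> sol \<Longrightarrow> s n \<in> Zp v"
  by (simp add: sol_def)

lemma sol_rec: "s \<in> sol \<Longrightarrow> s (n + l) = - (\<Sum>i<l. a i * s (n + i))"
  by (simp add: sol_def eq_neg_iff_add_eq_0)

lemma sol_add:
  assumes "s \<in> sol" "t \<in> sol"
  shows "(\<lambda>n. s n + t n) \<in> sol"
proof -
  have "s (n + l) + t (n + l) + (\<Sum>i<l. a i * (s (n + i) + t (n + i))) = 0" for n
    by (simp add: sol_rec assms distrib_left sum.distrib)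
  then show ?thesis using assms by (simp add: sol_def Zp_add)
qed

lemma sol_scale:
  assumes "s \<in> sol" "\<And>n. c * s n \<in> Zp v"
  shows "(\<lambda>n. c * s n) \<in> sol"
proof -
  have "c * s (n + l) + (\<Sum>i<l. a i * (c * s (n + i))) = c * (s (n + l) + (\<Sum>i<l. a i * s (n + i)))" for n
    by (simp add: distrib_left sum_distrib_left mult_ac)
  then show ?thesis using assms by (simp add: sol_def)
qed

lemma sol_shift: "s \<in> sol \<Longrightarrow> (\<lambda>n. s (n + k)) \<in> sol"
  unfolding sol_def
proof (intro CollectI conjI allI)
  fix n assume s: "s \<in> {s. (\<forall>n. s n \<in> Zp v) \<and> (\<forall>n. s (n + l) + (\<Sum>i<l. a i * s (n + i)) = 0)}"
  then show "s (n + k) \<in> Zp v" by blast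
  from s have "s (n + k + l) + (\<Sum>i<l. a i * s (n + k + i)) = 0" by blast
  then show "s (n + l + k) + (\<Sum>i<l. a i * s (n + i + k)) = 0"
    by (simp add: add_ac)
qed

lemma sol_diff:
  assumes "s \<in> sol" "t \<in> sol"
  shows "(\<lambda>n. s n - t n) \<in> sol"
proof -
  have "(\<lambda>n. -1 * t n) \<in> sol" using assms(2) by (rule sol_scale) (simp add: Zp_minus sol_Zp assms(2))
  from sol_add[OF assms(1) this] show ?thesis by simp
qed

lemma sol_shift_act: "s \<in> sol \<Longrightarrow> shift_act F s \<in> sol"
proof (induction F)
  case 0
  have "(\<lambda>n. 0 * s n) \<in> sol" using 0 by (rule sol_scale) simp
  then show ?case by (simp add: shift_act_def[abs_def])
next
  case (pCons c F)
  have "(\<lambda>n. of_int c * s n) \<in> sol"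
    using pCons.prems by (rule sol_scale) (simp add: Zp_mult sol_Zp pCons.prems)
  moreover have "(\<lambda>n. shift_act F s (n + 1)) \<in> sol"
    using sol_shift[OF pCons.IH[OF pCons.prems]] .
  ultimately have "(\<lambda>n. of_int c * s n + shift_act F s (n + 1)) \<in> sol" by (rule sol_add)
  moreover have "shift_act (pCons c F) s = (\<lambda>n. of_int c * s n + shift_act F s (n + 1))"
    by (rule ext) simp
  ultimately show ?case by (simp only:)
qed

text \<open>The recurrence is monic with integral coefficients, so by the ultrametric inequality a
  bound on the first \<open>l\<close> terms propagates to all later ones.\<close>

lemma sol_v_le:
  assumes s: "s \<in> sol" and init: "\<And>i. i < l \<Longrightarrow> v (s i) \<le> B" and B: "B \<ge> 0"
  shows "v (s n) \<le> B"
proof (induction n rule: less_induct)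
  case (less n)
  show ?case
  proof (cases "n < l")
    case False
    then obtain m where m: "n = m + l" by (metis add.commute le_add_diff_inverse not_less)
    have "v (\<Sum>i<l. a i * s (m + i)) \<le> B"
    proof (rule v_sum_le[OF B])
      fix i assume "i \<in> {..<l}"
      then have "v (a i) \<le> 1" "v (s (m + i)) \<le> B" using Zp_v_le_1[OF a_Zp] less m by auto
      then show "v (a i * s (m + i)) \<le> B"
        using mult_mono[of "v (a i)" 1 "v (s (m + i))" B] by (simp add: v_mult)
    qed
    then show ?thesis unfolding m sol_rec[OF s] by simp
  qed (use init in simp)
qed

text \<open>A solution all of whose values have absolute value at most \<open>\<rho> ^ k\<close> is \<open>p ^ k\<close> times a solution, so
  membership means mapping \<open>sol\<close> into \<open>p ^ k sol\<close>.\<close>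

definition shift_ideal :: "nat \<Rightarrow> int poly set" where
  "shift_ideal k = {F. \<forall>s\<in>sol. \<forall>n. v (shift_act F s n) \<le> \<rho> ^ k}"

text \<open>Dividing \<open>shift_act G s\<close> by \<open>p ^ k\<close> gives another element
  \<open>t\<close> of \<open>sol\<close>, to which the bound for \<open>F\<close> applies.\<close>

lemma shift_ideal_mult:
  assumes F: "F \<in> shift_ideal j" and G: "G \<in> shift_ideal k"
  shows "F * G \<in> shift_ideal (j + k)"
  unfolding shift_ideal_def
proof (intro CollectI ballI allI)
  fix s n assume s: "s \<in> sol"
  define t where "t = (\<lambda>n. inverse (of_nat p ^ k) * shift_act G s n)"
  have Gs: "shift_act G s \<in> sol" using s by (rule sol_shift_act)
  then have "t \<in> sol" unfolding t_def
  proof (rule sol_scale)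
    fix n
    have "v (shift_act G s n) \<le> \<rho> ^ k" using G s by (simp add: shift_ideal_def)
    from Zp_divide_p_power[OF sol_Zp[OF Gs] this] 
    show "inverse (of_nat p ^ k) * shift_act G s n \<in> Zp v" by (simp add: divide_inverse mult.commute)
  qed
  then have "v (shift_act F t n) \<le> \<rho> ^ j" using F by (simp add: shift_ideal_def)
  moreover have "shift_act G s = (\<lambda>n. of_nat p ^ k * t n)"
    using p_gt_1 by (simp add: t_def fun_eq_iff)
  then have "shift_act (F * G) s n = of_nat p ^ k * shift_act F t n"
    by (simp only: shift_act_mult shift_act_scale)
  ultimately show "v (shift_act (F * G) s n) \<le> \<rho> ^ (j + k)"
    by (simp add: v_mult v_power v_p power_add mult.commute mult_right_mono)
qed

sublocale filtration shift_ideal p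
proof
  show "shift_ideal 0 = UNIV"
    using Zp_v_le_1 sol_Zp sol_shift_act by (fastforce simp: shift_ideal_def)
  show "F + G \<in> shift_ideal k" if "F \<in> shift_ideal k" "G \<in> shift_ideal k" for F G k
    using that by (simp add: shift_ideal_def shift_act_add v_add_le)
  show "shift_ideal (Suc k) \<subseteq> shift_ideal k" for k
    using rho_power_antimono[of k "Suc k"] unfolding shift_ideal_def by (fastforce intro: order_trans)
  show "of_nat p \<in> shift_ideal 1"
    unfolding shift_ideal_def
  proof (intro CollectI ballI allI)
    fix s n assume "s \<in> sol"
    then have "v (s n) \<le> 1" by (simp add: Zp_v_le_1 sol_Zp)
    then show "v (shift_act (of_nat p) s n) \<le> \<rho> ^ 1"
      using rho_pos by (simp add: shift_act_of_nat v_mult v_p)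
  qed
qed (rule shift_ideal_mult)

text \<open>Pigeonhole on the \<open>p ^ l\<close> possible residues modulo \<open>p\<close> of \<open>l\<close> consecutive terms.\<close>

lemma sol_mod_p_periodic:
  assumes s: "s \<in> sol"
  obtains n0 k where "n0 \<le> p ^ l" "1 \<le> k" "k \<le> p ^ l" "\<And>n. n \<ge> n0 \<Longrightarrow> v (s (n + k) - s n) \<le> \<rho>"
proof -
  have "\<exists>d<p. v (of_nat d - s n) \<le> \<rho>" for n
    using Zp_approx_nat[OF sol_Zp[OF s], of 1 n] by simp
  then obtain res where res: "\<And>n. res n < p" "\<And>n. v (of_nat (res n) - s n) \<le> \<rho>" by metis
  define state where "state n = map (\<lambda>i. res (n + i)) [0..<l]" for n
  define X where "X = {xs. set xs \<subseteq> {..<p} \<and> length xs = l}"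
  have X: "finite X" "card X = p ^ l"
    by (simp_all add: X_def finite_lists_length_eq card_lists_length_eq)
  have "\<not> inj_on state {..p ^ l}"
  proof
    assume "inj_on state {..p ^ l}"
    moreover have "state ` {..p ^ l} \<subseteq> X" using res(1) by (auto simp: state_def X_def)
    ultimately have "card {..p ^ l} \<le> card X" using X(1) by (rule card_inj_on_le)
    then show False using X(2) by simp
  qed
  then obtain m n where "m \<le> p ^ l" "n \<le> p ^ l" "m \<noteq> n" "state m = state n"
    by (auto simp: inj_on_def)
  then obtain n0 n1 where n: "n0 < n1" "n1 \<le> p ^ l" "state n0 = state n1"
    by (metis linorder_neqE_nat)
  define k where "k = n1 - n0"
  have k: "n1 = n0 + k" "k \<ge> 1" using n(1) by (auto simp: k_def)
  \<comment> \<open>Equal states make this difference of two shifts small at the first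
    \<open>l\<close> indices. Being a solution, it is then small everywhere.\<close>
  define t where "t i = s (i + n1) - s (i + n0)" for i
  have "t \<in> sol" unfolding t_def by (intro sol_diff sol_shift s)
  moreover have "v (t i) \<le> \<rho>" if "i < l" for i
  proof -
    have "state n0 ! i = state n1 ! i" using n(3) by simp
    then have "res (n0 + i) = res (n1 + i)" using that by (simp add: state_def)
    then show ?thesis
      using v_triangle_le[of "s (n1 + i)" "of_nat (res (n1 + i))" \<rho> "s (n0 + i)"]
        res(2)[of "n1 + i"] res(2)[of "n0 + i"]
      by (simp add: t_def add.commute v_diff_commute)
  qed
  ultimately have t: "v (t i) \<le> \<rho>" for i using sol_v_le[of t \<rho> i] rho_pos by simp
  have "v (s (n + k) - s n) \<le> \<rho>" if "n \<ge> n0" for n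
  proof -
    have "n - n0 + n0 = n" "n - n0 + n1 = n + k" using that k(1) by auto
    then show ?thesis using t[of "n - n0"] by (simp only: t_def)
  qed
  then show ?thesis using that[of n0 k] n k by auto
qed

text \<open>The factorial is a multiple of every period \<open>k \<le> p ^ l\<close> and at least as
  large as every preperiod \<open>n0 \<le> p ^ l\<close>, so one shift \<open>T\<close> serves all
  solutions at once.\<close>

lemma shift_idempotent_mod_p:
  fixes T :: nat
  defines "T \<equiv> fact (p ^ l)"
  shows "(monom 1 T) ^ 2 - monom 1 T \<in> shift_ideal 1"
  unfolding shift_ideal_def
proof (intro CollectI ballI allI)
  fix s n assume s: "s \<in> sol"
  obtain n0 k where k: "n0 \<le> p ^ l" "1 \<le> k" "k \<le> p ^ l"
    and per: "\<And>n. n \<ge> n0 \<Longrightarrow> v (s (n + k) - s n) \<le> \<rho>"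
    using sol_mod_p_periodic[OF s] by metis
  have per': "v (s (n + k * j) - s n) \<le> \<rho>" if "n \<ge> n0" for n j
  proof (induction j)
    case (Suc j)
    have "v (s (n + k * j + k) - s (n + k * j)) \<le> \<rho>" using that by (intro per) simp
    then show ?case using v_triangle_le[OF _ Suc] by (simp add: add_ac)
  qed (use rho_pos in simp)
  have "k dvd T" unfolding T_def using k by (intro dvd_fact)
  then obtain j where "T = k * j" ..
  moreover have "T \<ge> n0" using k(1) fact_ge_self[of "p ^ l"] by (simp add: T_def)
  ultimately have "v (s (n + T + T) - s (n + T)) \<le> \<rho>" using per'[of "n + T" j] by simp
  then show "v (shift_act ((monom 1 T) ^ 2 - monom 1 T) s n) \<le> \<rho> ^ 1"
    by (simp add: shift_act_diff shift_act_monom monom_power power2_eq_square mult_monom add_ac)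
qed

text \<open>With \<open>P\<close> the shift by \<open>T\<close>, the powers \<open>P ^ (p ^ h)\<close> tend to the idempotent that projects onto
  the part on which the shift is invertible. The \<open>c k\<close> are the iterated differences of the projected
  sequence along a residue class modulo \<open>T\<close>.\<close>

lemma newton_approximation:
  fixes T :: nat
  defines "T \<equiv> p * fact (p ^ l)"
  assumes s: "s \<in> sol"
  shows "\<exists>c. (\<forall>k. c k \<in> Qp v \<and> v (c k) \<le> \<rho> ^ (2 * k)) \<and>
    (\<forall>m. v (s (i + T * m) - (\<Sum>k\<le>m. of_nat (m choose k) * c k)) \<le> \<rho> ^ (2 * m))"
proof -
  define P :: "int poly" where "P = monom 1 T"
  \<comment> \<open>Multiplying by \<open>X\<close> moves the starting point to \<open>i\<close>, so
    every operator can be evaluated at index 0.\<close>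
  define X :: "int poly" where "X = monom 1 i"
  define E where "E h = P ^ p ^ h" for h
  \<comment> \<open>\<open>P\<close> is the \<open>p\<close>-th power of a shift idempotent modulo
    \<open>p\<close>, hence idempotent modulo \<open>p ^ 2\<close>. Of the two factors
    \<open>p\<close> gained per difference, one is later absorbed by the factorial.\<close>
  have P_eq: "P = (monom 1 (fact (p ^ l))) ^ p" by (simp add: P_def T_def monom_power mult.commute)
  then have "P ^ 2 = ((monom 1 (fact (p ^ l))) ^ 2) ^ p" by (simp flip: power_mult add: mult.commute)
  with P_eq have P2: "P ^ 2 - P \<in> shift_ideal 2"
    using I_diff_power_p[of "(monom 1 (fact (p ^ l))) ^ 2" "monom 1 (fact (p ^ l))" 0]
      shift_idempotent_mod_p by (simp add: numeral_2_eq_2)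
  then have P1: "P ^ 2 - P \<in> shift_ideal 1" by (rule I_antimono[rotated]) simp
  have bound: "v (shift_act F s 0) \<le> \<rho> ^ k" if "F \<in> shift_ideal k" for F k
    using that s by (simp add: shift_ideal_def)
  have p1: "p \<ge> 1" using p_gt_1 by simp
  \<comment> \<open>No limit operator \<open>E\<close> is formed; only the values of its
    approximations \<open>E h\<close> on \<open>s\<close> are passed to the limit.\<close>
  have "\<exists>c\<in>Qp v. vlim v (\<lambda>h. shift_act (X * (P - 1) ^ k * E h) s 0) c" for k
  proof -
    have "v (shift_act (X * (P - 1) ^ k * E (Suc h)) s 0 - shift_act (X * (P - 1) ^ k * E h) s 0)
        \<le> \<rho> ^ h" for h
    proof -
      have "X * (P - 1) ^ k * (E (Suc h) - E h) \<in> shift_ideal (Suc h)"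
        unfolding E_def by (intro I_mult_left I_p_power_Cauchy P1 p1)
      then have "X * (P - 1) ^ k * (E (Suc h) - E h) \<in> shift_ideal h" using I_Suc by blast
      from bound[OF this] show ?thesis by (simp only: right_diff_distrib shift_act_diff)
    qed
    moreover have "shift_act (X * (P - 1) ^ k * E h) s 0 \<in> Qp v" for h
      using sol_Zp[OF sol_shift_act[OF s]] Zp_subset_Qp by blast
    ultimately show ?thesis using Qp_geometric_limit[of "\<lambda>h. shift_act (X * (P - 1) ^ k * E h) s 0"] by blast
  qed
  then obtain c where cQ: "\<And>k. c k \<in> Qp v"
    and c: "\<And>k. vlim v (\<lambda>h. shift_act (X * (P - 1) ^ k * E h) s 0) (c k)" by metis
  have "v (c k) \<le> \<rho> ^ (2 * k)" for k
  proof (rule vlim_v_le[OF c])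
    fix h assume "h \<ge> k"
    moreover have "h < p ^ h" using p_gt_1 by (intro power_gt_expt) simp
    ultimately have "k \<le> p ^ h" by simp
    then have "(P - 1) ^ k * E h \<in> shift_ideal (2 * k)" unfolding E_def by (intro I_diff_one_power P2)
    from bound[OF I_mult_left[OF this, of X]]
    show "v (shift_act (X * (P - 1) ^ k * E h) s 0) \<le> \<rho> ^ (2 * k)" by (simp only: mult.assoc)
  qed
  moreover have "v (s (i + T * m) - (\<Sum>k\<le>m. of_nat (m choose k) * c k)) \<le> \<rho> ^ (2 * m)" for m
  proof -
    have lim: "vlim v (\<lambda>h. \<Sum>k\<le>m. of_nat (m choose k) * shift_act (X * (P - 1) ^ k * E h) s 0)
        (\<Sum>k\<le>m. of_nat (m choose k) * c k)"
      by (intro vlim_sum vlim_mult vlim_const c)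
    \<comment> \<open>Newton's forward difference formula, from the binomial expansion of
      \<open>((P - 1) + 1) ^ m\<close>.\<close>
    have "(\<Sum>k\<le>m. of_nat (m choose k) * shift_act (X * (P - 1) ^ k * E h) s 0)
        = shift_act (X * P ^ m * E h) s 0" for h
    proof -
      have "P ^ m = ((P - 1) + 1) ^ m" by simp
      also have "\<dots> = (\<Sum>k\<le>m. of_nat (m choose k) * (P - 1) ^ k)"
        unfolding binomial_ring by simp
      finally have "X * P ^ m * E h = (\<Sum>k\<le>m. of_nat (m choose k) * (X * (P - 1) ^ k * E h))"
        by (simp add: sum_distrib_left sum_distrib_right mult_ac)
      then show ?thesis by (simp only: shift_act_sum shift_act_mult[of "of_nat _"] shift_act_of_nat)
    qed
    with lim have lim': "vlim v (\<lambda>h. shift_act (X * P ^ m * E h) s 0) (\<Sum>k\<le>m. of_nat (m choose k) * c k)"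
      by simp
    have sm: "s (i + T * m) = shift_act (X * P ^ m) s 0"
      by (simp add: X_def P_def monom_power mult_monom shift_act_monom)
    show ?thesis unfolding sm
    proof (rule vlim_v_le[OF vlim_diff[OF vlim_const lim']])
      \<comment> \<open>Only large \<open>h\<close> matter in the limit; this threshold gives the
        condition \<open>2 * m \<le> Suc h\<close> of \<open>I_complement_power\<close>.\<close>
      fix h assume "h \<ge> 2 * m"
      then have "P ^ m * (E h - 1) \<in> shift_ideal (2 * m)"
        unfolding E_def by (intro I_complement_power P2 p1) simp
      from bound[OF I_mult_left[OF this, of X]]
      show "v (shift_act (X * P ^ m) s 0 - shift_act (X * P ^ m * E h) s 0) \<le> \<rho> ^ (2 * m)"
        by (simp add: right_diff_distrib shift_act_diff mult.assoc v_diff_commute)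
    qed
  qed
  ultimately show ?thesis using cQ by blast
qed

end

section \<open>The interpolation\<close>

lemma (in padic_recurrence) exists_analytic_interpolation:
  assumes s: "s \<in> sol"
  shows "\<exists>(q::nat) (J::nat set) (A::nat \<Rightarrow> nat set) (r::nat \<Rightarrow> nat) (K::'k set) (sj::nat \<Rightarrow> 'k \<Rightarrow> 'k).
           approx_twisted_interp p v s q J A r K sj \<and> analytic_interp v q J r K sj"
proof -
  define T where "T = p * fact (p ^ l)"
  have T0: "T > 0" using p_gt_1 by (simp add: T_def)
  obtain T' where T: "T = p ^ multiplicity p T * T'" and T': "\<not> p dvd T'"
    by (rule multiplicity_decompose'[of T p]) (use T0 p_gt_1 in simp_all)
  define e where "e = multiplicity p T"
  note T = T[folded e_def]
  define q where "q = p ^ e"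
  have q0: "q > 0" using p_gt_1 by (simp add: q_def)
  \<comment> \<open>The partition consists of the residue classes modulo \<open>T\<close>. Several
    of them may be dense in the same coset, since that coset depends only on
    \<open>i mod q\<close>.\<close>
  define A where "A i = {n. n mod T = i}" for i
  define r where "r i = i mod q" for i
  obtain c where c: "\<And>i k. c i k \<in> Qp v" "\<And>i k. v (c i k) \<le> \<rho> ^ (2 * k)"
    and approx: "\<And>i m. v (s (i + T * m) - (\<Sum>k\<le>m. of_nat (m choose k) * c i k)) \<le> \<rho> ^ (2 * m)"
    using newton_approximation[OF s, folded T_def] by metis
  \<comment> \<open>On the coset, \<open>z\<close> is written as \<open>i + T * y\<close> and the
    Newton series is evaluated at \<open>y\<close>. The value 0 elsewhere does not disturb
    continuity, because the coset is open and closed in \<open>Zp v\<close>.\<close>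
  define sj where "sj i z = (if z \<in> coset_Zp v (r i) q
    then newton_sum (c i) ((z - of_nat i) / of_nat T) else 0)" for i z
  have coset: "coset_Zp v (r i) q = {of_nat i + of_nat T * y | y. y \<in> Zp v}" for i
    unfolding r_def q_def using T T' by (rule coset_Zp_eq)
  have sj: "sj i (of_nat i + of_nat T * y) = newton_sum (c i) y" if "y \<in> Zp v" for i y
    using that T0 by (auto simp: sj_def coset)
  have dense: "dense_in_Zp v (A i) (coset_Zp v (r i) q)" if "i < T" for i
    unfolding A_def r_def q_def using T T' that by (rule dense_residue_class)
  have range_Qp: "sj i ` Zp v \<subseteq> Qp v" for i
    using sj newton_sum_vlim(2)[OF c] by (force simp: sj_def coset)
  have cont: "continuous_on_Zp v (sj i)" for i
    unfolding continuous_on_Zp_def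
  proof (intro ballI allI impI)
    fix x and \<epsilon> :: real assume x: "x \<in> Zp v" and \<epsilon>: "\<epsilon> > 0"
    have vT: "v (of_nat T) > 0" using T0 by simp
    \<comment> \<open>Distance below \<open>\<rho> ^ e\<close> puts \<open>x\<close> and
      \<open>y\<close> in the same coset of \<open>q\<close>; the factor \<open>v (of_nat T)\<close>
      compensates for the division by \<open>T\<close> in the Newton variable.\<close>
    define d where "d = min (\<rho> ^ e) (\<epsilon> * v (of_nat T))"
    have "d > 0" using \<epsilon> vT by (simp add: d_def)
    moreover have "v (sj i y - sj i x) < \<epsilon>" if y: "y \<in> Zp v" and d: "v (y - x) < d" for y
    proof -
      have "(y - x) / of_nat p ^ e \<in> Zp v"
        using d by (intro Zp_divide_p_power Zp_diff x y) (simp add: d_def)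
      then obtain w where w: "w \<in> Zp v" "y - x = of_nat q * w"
        using p_gt_1 by (auto simp: q_def intro!: that[of "(y - x) / of_nat p ^ e"])
      have iff: "y \<in> coset_Zp v (r i) q \<longleftrightarrow> x \<in> coset_Zp v (r i) q"
      proof
        assume "y \<in> coset_Zp v (r i) q"
        then obtain u where "u \<in> Zp v" "y = of_nat (r i) + of_nat q * u" by (auto simp: coset_Zp_def)
        then show "x \<in> coset_Zp v (r i) q" unfolding coset_Zp_def
          using w by (intro CollectI exI[of _ "u - w"]) (auto simp: algebra_simps Zp_diff)
      next
        assume "x \<in> coset_Zp v (r i) q"
        then obtain u where "u \<in> Zp v" "x = of_nat (r i) + of_nat q * u" by (auto simp: coset_Zp_def)
        then show "y \<in> coset_Zp v (r i) q" unfolding coset_Zp_def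
          using w by (intro CollectI exI[of _ "u + w"]) (auto simp: algebra_simps Zp_add)
      qed
      show ?thesis
      proof (cases "x \<in> coset_Zp v (r i) q")
        case True
        with iff obtain x' y' where xy: "x' \<in> Zp v" "x = of_nat i + of_nat T * x'"
          "y' \<in> Zp v" "y = of_nat i + of_nat T * y'" by (auto simp: coset)
        have "y - x = of_nat T * (y' - x')" by (simp add: xy algebra_simps)
        then have "v (y - x) = v (of_nat T) * v (y' - x')" by (simp only: v_mult)
        moreover have "v (y - x) < \<epsilon> * v (of_nat T)" using d by (simp add: d_def)
        ultimately have "v (y' - x') < \<epsilon>" using vT by (simp add: mult.commute)
        then show ?thesis using newton_sum_lipschitz[OF c xy(3,1)] xy(1,3)
          unfolding xy(2,4) by (simp only: sj) (rule le_less_trans)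
      qed (use iff \<epsilon> in \<open>simp add: sj_def\<close>)
    qed
    ultimately show "\<exists>d>0. \<forall>y\<in>Zp v. v (y - x) < d \<longrightarrow> v (sj i y - sj i x) < \<epsilon>" by blast
  qed
  \<comment> \<open>Take \<open>C = p\<close> and \<open>D = root T \<rho>\<close>: since
    \<open>n < T * Suc m\<close>, the error is at most
    \<open>\<rho> ^ m = p * D ^ (T * Suc m) \<le> p * D ^ n\<close>.\<close>
  have close: "v (s n - sj i (of_nat n)) \<le> real p * root T \<rho> ^ n" if "i < T" "n \<in> A i" for i n
  proof -
    define m where "m = n div T"
    have n: "n = i + T * m" using that by (auto simp: A_def m_def)
    have "sj i (of_nat n) = (\<Sum>k\<le>m. of_nat (m choose k) * c i k)"
      using sj[OF Zp_of_nat[of m], of i] by (simp add: n newton_sum_of_nat)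
    then have "v (s n - sj i (of_nat n)) \<le> \<rho> ^ (2 * m)" using approx[of i m] by (simp add: n)
    also have "\<dots> \<le> \<rho> ^ m" by (rule rho_power_antimono) simp
    also have "\<dots> = real p * \<rho> ^ Suc m" using p_gt_1 by (simp add: \<rho>_def)
    also have "\<rho> ^ Suc m = root T \<rho> ^ (T * Suc m)" using T0 rho_pos by (simp only: power_mult real_root_pow_pos)
    also have "root T \<rho> ^ (T * Suc m) \<le> root T \<rho> ^ n"
      by (rule power_decreasing) (use that n T0 rho_pos rho_less_1 in \<open>auto intro: less_imp_le\<close>)
    finally show ?thesis by (simp add: mult_left_mono)
  qed
  have "approx_twisted_interp p v s q {..<T} A r (Qp v) sj"
    unfolding approx_twisted_interp_def
  proof (intro conjI)
    show "\<Union> (A ` {..<T}) = UNIV" using T0 by (auto simp: A_def)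
    show "\<forall>i\<in>{..<T}. r i \<le> q - 1 \<and> dense_in_Zp v (A i) (coset_Zp v (r i) q)"
    proof (intro ballI conjI)
      fix i
      have "i mod q < q" using q0 by simp
      then show "r i \<le> q - 1" by (simp add: r_def)
    qed (use dense in simp)
    show "\<exists>C D. 0 \<le> C \<and> 0 \<le> D \<and> D < 1 \<and>
        (\<forall>j\<in>{..<T}. \<forall>n\<in>A j. v (s n - sj j (of_nat n)) \<le> C * D ^ n)"
      using close T0 rho_pos rho_less_1
      by (intro exI[of _ "real p"] exI[of _ "root T \<rho>"]) auto
  qed (use q0 range_Qp cont finite_ext_Qp_Qp in \<open>auto simp: A_def q_def\<close>)
  moreover have "analytic_interp v q {..<T} r (Qp v) sj"
    unfolding analytic_interp_def
  proof
    fix i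
    \<comment> \<open>Solving \<open>i + T * y = r i + q * x\<close> for \<open>y\<close> gives
      \<open>y = a0 + b * x\<close>, with both coefficients integral because \<open>p\<close> does
      not divide \<open>T'\<close>.\<close>
    define b :: 'k where "b = inverse (of_nat T')"
    have b: "b \<in> Zp v" unfolding b_def using T' by (rule Zp_inverse_of_nat)
    define a0 where "a0 = - (b * of_nat (i div q))"
    have a0: "a0 \<in> Zp v" unfolding a0_def using b by (intro Zp_minus Zp_mult) auto
    have "of_nat q * x + of_nat (r i) = of_nat i + of_nat T * (a0 + b * x)" for x
      using coset_reparametrization[OF T T', of i x]
      by (simp add: a0_def b_def q_def r_def algebra_simps)
    then have "sj i (of_nat q * x + of_nat (r i)) = newton_sum (c i) (a0 + b * x)" if "x \<in> Zp v" for x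
      using that a0 b by (simp add: sj Zp_add Zp_mult)
    then show "\<exists>c. (\<forall>k. c k \<in> Qp v) \<and> (\<forall>x\<in>Zp v.
        vlim v (\<lambda>N. \<Sum>k<N. c k * x ^ k) (sj i (of_nat q * x + of_nat (r i))))"
      using newton_sum_affine_power_series[OF c a0 b] by simp
  qed
  ultimately show ?thesis by blast
qed

theorem theorem3p4:
  fixes p :: nat and v :: "'k::field_char_0 \<Rightarrow> real"
    and s :: "nat \<Rightarrow> 'k" and l :: nat and a :: "nat \<Rightarrow> 'k"
  assumes "prime p"
    and "padic_ambient p v"
    and "\<forall>n. s n \<in> Zp v"
    and "\<forall>i<l. a i \<in> Zp v"
    and "\<forall>n. s (n + l) + (\<Sum>i<l. a i * s (n + i)) = 0"
  shows "\<exists>(q::nat) (J::nat set) (A::nat \<Rightarrow> nat set) (r::nat \<Rightarrow> nat) (K::'k set) (sj::nat \<Rightarrow> 'k \<Rightarrow> 'k).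
           approx_twisted_interp p v s q J A r K sj \<and> analytic_interp v q J r K sj"
proof -
  interpret padic_recurrence p v l a
    using assms by unfold_locales auto
  show ?thesis
    by (rule exists_analytic_interpolation) (use assms in \<open>simp add: sol_def\<close>)
qed

end
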